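(* Let $R$ be a complete Noetherian (commutative) local ring and $\mathcal M$ a class of Matlis-dualizable $R$-modules closed under taking submodules and quotient modules. Let $r$ be a residual operation on $\mathcal M$, and let $\mathrm{i}$ be the submodule selector on $\mathcal M^\vee$ defined by $\mathrm{i}(N)=(N^\vee/0^r_{N^\vee})^\vee\subseteq N$ for $N\in\mathcal M^\vee$. Then: (1) $r$ is order-preserving on submodules if and only if $\mathrm{i}$ is order-preserving. (2) $r$ is idempotent if and only if $\mathrm{i}$ is idempotent. (3) $r$ is a closure operation if and only if $\mathrm{i}$ is an interior operation. (4) Suppose $r$ is a closure operation (i.e. $\mathrm{i}$ is an interior operation). Then the following are equivalent: (a) $r$ is functorial; (b) $r$ is order-preserving on ambient modules; (c) $\mathrm{i}$ is surjection-functorial; (d) $\mathrm{i}$ is functorial.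
   Context: Let $E$ be the injective hull of the residue field of $R$ and $(-)^\vee=\operatorname{Hom}_R(-,E)$. A module $M$ is Matlis-dualizable if the natural map $M\to M^{\vee\vee}$ is an isomorphism; $M$ and $M^{\vee\vee}$ are identified. $\mathcal M$ is taken closed under isomorphism, and $\mathcal M^\vee$ is the class of modules isomorphic to $M^\vee$ for some $M\in\mathcal M$. The module $(N^\vee/0^r_{N^\vee})^\vee$ is regarded as a submodule of $N\cong N^{\vee\vee}$ via the dual of the quotient map $N^\vee\to N^\vee/0^r_{N^\vee}$. A submodule selector on a class $\mathcal C$ of modules is a function $\alpha:\mathcal C\to\mathcal C$ with $\alpha(M)$ a submodule of $M$ and $\varphi(\alpha(M))=\alpha(N)$ for every isomorphism $\varphi:M\to N$ in $\mathcal C$. It is: order-preserving if $\alpha(L)\subseteq\alpha(M)$ whenever $L\subseteq M$ in $\mathcal C$; surjection-functorial if $\pi(\alpha(M))\subseteq\alpha(N)$ for every surjection $\pi:M\to N$ in $\mathcal C$; functorial if $g(\alpha(M))\subseteq\alpha(N)$ for every homomorphism $g:M\to N$ in $\mathcal C$ (equivalently, order-preserving and surjection-functorial); idempotent if $\alpha(\alpha(M))=\alpha(M)$ for all $M$; an interior operation if it is idempotent and order-preserving. An extensive operation $e$ on $\mathcal M$ assigns to each pair $L\subseteq M$ in $\mathcal M$ a submodule $L^e_M$ with $L\subseteq L^e_M\subseteq M$, such that $\varphi(L^e_M)=\varphi(L)^e_N$ for every isomorphism $\varphi:M\to N$ in $\mathcal M$. A residual operation is an extensive operation $r$ with $(\ker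 q)^r_M=q^{-1}(0^r_P)$ for every surjection $q:M\to P$ in $\mathcal M$. An extensive operation $e$ is: order-preserving on submodules if $L^e_N\subseteq M^e_N$ whenever $L\subseteq M\subseteq N$ in $\mathcal M$; order-preserving on ambient modules if $L^e_M\subseteq L^e_N$ whenever $L\subseteq M\subseteq N$ in $\mathcal M$; idempotent if $(L^e_M)^e_M=L^e_M$ for all $L\subseteq M$; functorial if $g(L^e_M)\subseteq g(L)^e_N$ for every $L\subseteq M$ in $\mathcal M$ and every homomorphism $g:M\to N$ in $\mathcal M$; a closure operation if it is order-preserving on submodules and idempotent. *)

theory Defs
  imports "HOL-Algebra.Module" "HOL-Algebra.Ring_Divisibility" "HOL-Algebra.Ideal_Product"
begin

section \<open>Homomorphisms, quotients and the regular module\<close>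

text \<open>The record type of modules inherits the fields \<open>mult\<close> and \<open>one\<close> from rings.  They play no
  role for modules, and all notions below depend only on carrier, addition, zero and scalar
  multiplication.\<close>

definition mod_hom ::
  "('r, 'x) ring_scheme \<Rightarrow> ('r, 'a) module \<Rightarrow> ('r, 'b) module \<Rightarrow> ('a \<Rightarrow> 'b) set" where
  "mod_hom R M N = {f \<in> carrier M \<rightarrow> carrier N.
     (\<forall>x\<in>carrier M. \<forall>y\<in>carrier M. f (x \<oplus>\<^bsub>M\<^esub> y) = f x \<oplus>\<^bsub>N\<^esub> f y) \<and>
     (\<forall>a\<in>carrier R. \<forall>x\<in>carrier M. f (a \<odot>\<^bsub>M\<^esub> x) = a \<odot>\<^bsub>N\<^esub> f x)}"

definition mod_surj ::
  "('r, 'x) ring_scheme \<Rightarrow> ('r, 'a) module \<Rightarrow> ('r, 'b) module \<Rightarrow> ('a \<Rightarrow> 'b) set" where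
  "mod_surj R M N = {f \<in> mod_hom R M N. f ` carrier M = carrier N}"

definition mod_iso ::
  "('r, 'x) ring_scheme \<Rightarrow> ('r, 'a) module \<Rightarrow> ('r, 'b) module \<Rightarrow> ('a \<Rightarrow> 'b) set" where
  "mod_iso R M N = {f \<in> mod_hom R M N. bij_betw f (carrier M) (carrier N)}"

definition ring_as_module :: "('r, 'x) ring_scheme \<Rightarrow> ('r, 'r) module" where
  "ring_as_module R = \<lparr>carrier = carrier R, monoid.mult = monoid.mult R, one = \<one>\<^bsub>R\<^esub>, zero = \<zero>\<^bsub>R\<^esub>,
     add = add R, smult = monoid.mult R\<rparr>"

definition mod_quot :: "('r, 'a) module \<Rightarrow> 'a set \<Rightarrow> ('r, 'a set) module" where
  "mod_quot M L = \<lparr>carrier = a_rcosets\<^bsub>M\<^esub> L, monoid.mult = undefined, one = undefined, zero = L,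
     add = set_add M, smult = (\<lambda>a X. \<Union>x\<in>X. L +>\<^bsub>M\<^esub> (a \<odot>\<^bsub>M\<^esub> x))\<rparr>"

section \<open>Complete Noetherian local rings\<close>

definition local_ring :: "('r, 'x) ring_scheme \<Rightarrow> bool" where
  "local_ring R \<longleftrightarrow> cring R \<and> (\<exists>!m. maximalideal m R)"

definition max_ideal :: "('r, 'x) ring_scheme \<Rightarrow> 'r set" where
  "max_ideal R = (THE m. maximalideal m R)"

definition residue_field_module :: "('r, 'x) ring_scheme \<Rightarrow> ('r, 'r set) module" where
  "residue_field_module R = mod_quot (ring_as_module R) (max_ideal R)"

text \<open>Bijectivity of the natural map from \<open>R\<close> to the inverse limit of the rings \<open>R / I\<^sup>n\<close>: every
  coherent sequence of residue classes comes from exactly one ring element.\<close>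

definition adically_complete :: "('r, 'x) ring_scheme \<Rightarrow> 'r set \<Rightarrow> bool" where
  "adically_complete R I \<longleftrightarrow>
     (\<forall>x :: nat \<Rightarrow> 'r.
        (\<forall>n. x n \<in> carrier R \<and> x (Suc n) \<ominus>\<^bsub>R\<^esub> x n \<in> I [^]\<^bsub>ideals_set R\<^esub> n) \<longrightarrow>
        (\<exists>!y. y \<in> carrier R \<and> (\<forall>n. y \<ominus>\<^bsub>R\<^esub> x n \<in> I [^]\<^bsub>ideals_set R\<^esub> n)))"

definition complete_noetherian_local_ring :: "('r, 'x) ring_scheme \<Rightarrow> bool" where
  "complete_noetherian_local_ring R \<longleftrightarrow>
     local_ring R \<and> noetherian_ring R \<and> adically_complete R (max_ideal R)"

section \<open>Injective hulls\<close>

text \<open>A definition cannot quantify over all types, so the type of the test modules is a parameter.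
  Theorem \<open>injective_module_any_type\<close> below (Baer's criterion) shows that testing against modules
  over the type of ring elements implies the extension property against modules over every type.\<close>

definition injective_module ::
  "'b itself \<Rightarrow> ('r, 'x) ring_scheme \<Rightarrow> ('r, 'e) module \<Rightarrow> bool" where
  "injective_module T R E \<longleftrightarrow> module R E \<and>
     (\<forall>(B :: ('r, 'b) module) A. module R B \<and> submodule A R B \<longrightarrow>
        (\<forall>f\<in>mod_hom R (B\<lparr>carrier := A\<rparr>) E. \<exists>g\<in>mod_hom R B E. \<forall>x\<in>A. g x = f x))"

definition injective_hull ::
  "('r, 'x) ring_scheme \<Rightarrow> ('r, 'k) module \<Rightarrow> ('r, 'e) module \<Rightarrow> bool" where
  "injective_hull R K E \<longleftrightarrow> injective_module TYPE('r) R E \<and>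
     (\<exists>\<iota>\<in>mod_hom R K E. inj_on \<iota> (carrier K) \<and>
        (\<forall>H. submodule H R E \<and> H \<noteq> {\<zero>\<^bsub>E\<^esub>} \<longrightarrow> H \<inter> \<iota> ` carrier K \<noteq> {\<zero>\<^bsub>E\<^esub>}))"

lemma mod_homD:
  assumes "f \<in> mod_hom R M N"
  shows "x \<in> carrier M \<Longrightarrow> f x \<in> carrier N"
    and "x \<in> carrier M \<Longrightarrow> y \<in> carrier M \<Longrightarrow> f (x \<oplus>\<^bsub>M\<^esub> y) = f x \<oplus>\<^bsub>N\<^esub> f y"
    and "a \<in> carrier R \<Longrightarrow> x \<in> carrier M \<Longrightarrow> f (a \<odot>\<^bsub>M\<^esub> x) = a \<odot>\<^bsub>N\<^esub> f x"
  using assms by (auto simp: mod_hom_def)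

lemma module_ring_as_module:
  assumes "cring R"
  shows "module R (ring_as_module R)"
proof -
  interpret cring R by fact
  show ?thesis
  proof (rule moduleI[OF assms])
    show "abelian_group (ring_as_module R)"
      by (rule abelian_groupI)
         (auto simp: ring_as_module_def a_ac intro: bexI[of _ "\<ominus>\<^bsub>R\<^esub> x" for x] l_neg)
  qed (auto simp: ring_as_module_def l_distr r_distr m_assoc)
qed

theorem injective_module_any_type:
  fixes R :: "('r, 'x) ring_scheme" and E :: "('r, 'e) module"
  assumes inj: "injective_module TYPE('r) R E"
  shows "injective_module TYPE('b) R E"
  unfolding injective_module_def
proof (intro conjI allI impI ballI)
  show modE: "module R E" using inj by (simp add: injective_module_def)
  fix B :: "('r, 'b) module" and A f
  assume BA: "module R B \<and> submodule A R B" and f: "f \<in> mod_hom R (B\<lparr>carrier := A\<rparr>) E"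
  interpret R: cring R using modE by (rule module.axioms(1))
  interpret E: module R E by (fact modE)
  interpret B: module R B using BA by simp
  have subA: "submodule A R B" using BA by simp
  note A = B.submoduleE[OF subA]
  have zeroA: "\<zero>\<^bsub>B\<^esub> \<in> A"
  proof -
    obtain a where "a \<in> A" using A(2) by blast
    then show ?thesis using A(4)[of "\<zero>\<^bsub>R\<^esub>" a] A(1) by auto
  qed
  define P where "P G \<longleftrightarrow> G \<subseteq> carrier B \<times> carrier E \<and> (\<lambda>x. (x, f x)) ` A \<subseteq> G \<and>
      (\<forall>x y x' y'. (x, y) \<in> G \<longrightarrow> (x', y') \<in> G \<longrightarrow> (x \<oplus>\<^bsub>B\<^esub> x', y \<oplus>\<^bsub>E\<^esub> y') \<in> G) \<and>
      (\<forall>a x y. a \<in> carrier R \<longrightarrow> (x, y) \<in> G \<longrightarrow> (a \<odot>\<^bsub>B\<^esub> x, a \<odot>\<^bsub>E\<^esub> y) \<in> G) \<and>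
      (\<forall>x y y'. (x, y) \<in> G \<longrightarrow> (x, y') \<in> G \<longrightarrow> y = y')" for G
  have P0: "P ((\<lambda>x. (x, f x)) ` A)"
    using mod_homD[OF f] A(1,4,5) unfolding P_def by auto
  have "\<exists>G\<in>Collect P. \<forall>X\<in>Collect P. G \<subseteq> X \<longrightarrow> X = G"
  proof (rule subset_Zorn_nonempty)
    show "Collect P \<noteq> {}" using P0 by auto
    fix C assume ne: "C \<noteq> {}" and ch: "subset.chain (Collect P) C"
    have CP: "\<And>G. G \<in> C \<Longrightarrow> P G" using ch by (auto simp: subset_chain_def)
    have two: "\<exists>G\<in>C. p \<in> G \<and> q \<in> G" if "p \<in> \<Union>C" "q \<in> \<Union>C" for p q
      using that ch unfolding subset_chain_def by blast
    have "P (\<Union>C)"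
      unfolding P_def
    proof (intro conjI allI impI)
      show "\<Union>C \<subseteq> carrier B \<times> carrier E" using CP unfolding P_def by blast
      show "(\<lambda>x. (x, f x)) ` A \<subseteq> \<Union>C" using CP ne unfolding P_def by blast
    next
      fix x y x' y' assume "(x, y) \<in> \<Union>C" "(x', y') \<in> \<Union>C"
      then obtain G where "G \<in> C" "(x, y) \<in> G" "(x', y') \<in> G" using two by blast
      then show "(x \<oplus>\<^bsub>B\<^esub> x', y \<oplus>\<^bsub>E\<^esub> y') \<in> \<Union>C" using CP unfolding P_def by blast
    next
      fix a x y assume "a \<in> carrier R" "(x, y) \<in> \<Union>C"
      then show "(a \<odot>\<^bsub>B\<^esub> x, a \<odot>\<^bsub>E\<^esub> y) \<in> \<Union>C" using CP unfolding P_def by blast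
    next
      fix x y y' assume "(x, y) \<in> \<Union>C" "(x, y') \<in> \<Union>C"
      then obtain G where "G \<in> C" "(x, y) \<in> G" "(x, y') \<in> G" using two by blast
      then show "y = y'" using CP unfolding P_def by blast
    qed
    then show "\<Union>C \<in> Collect P" by simp
  qed
  then obtain G where PG: "P G" and max: "\<And>X. P X \<Longrightarrow> G \<subseteq> X \<Longrightarrow> X = G" by blast
  note PG' = PG[unfolded P_def]
  have Gc: "x \<in> carrier B" "y \<in> carrier E" if "(x, y) \<in> G" for x y
    using conjunct1[OF PG'] that by auto
  have GA: "(x, f x) \<in> G" if "x \<in> A" for x
    using conjunct1[OF conjunct2[OF PG']] that by auto
  note PG' = PG'[THEN conjunct2, THEN conjunct2]
  have Gadd: "(x \<oplus>\<^bsub>B\<^esub> x', y \<oplus>\<^bsub>E\<^esub> y') \<in> G" if "(x, y) \<in> G" "(x', y') \<in> G" for x y x' y'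
    using conjunct1[OF PG'] that by simp
  have Gsm: "(a \<odot>\<^bsub>B\<^esub> x, a \<odot>\<^bsub>E\<^esub> y) \<in> G" if "a \<in> carrier R" "(x, y) \<in> G" for a x y
    using conjunct1[OF conjunct2[OF PG']] that by simp
  have Gun: "y = y'" if "(x, y) \<in> G" "(x, y') \<in> G" for x y y'
    using conjunct2[OF conjunct2[OF PG']] that by simp
  have G0: "(\<zero>\<^bsub>B\<^esub>, \<zero>\<^bsub>E\<^esub>) \<in> G"
    using Gsm[OF R.zero_closed GA[OF zeroA]] Gc[OF GA[OF zeroA]] by simp
  have Gmin: "(\<ominus>\<^bsub>B\<^esub> x, \<ominus>\<^bsub>E\<^esub> y) \<in> G" if "(x, y) \<in> G" for x y
    using Gsm[of "\<ominus>\<^bsub>R\<^esub> \<one>\<^bsub>R\<^esub>", OF _ that] Gc[OF that] by (simp add: B.smult_l_minus E.smult_l_minus)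
  have total: "\<exists>y. (b, y) \<in> G" if b: "b \<in> carrier B" for b
  proof -
    define I where "I = {a \<in> carrier R. \<exists>y. (a \<odot>\<^bsub>B\<^esub> b, y) \<in> G}"
    define h where "h a = (THE y. (a \<odot>\<^bsub>B\<^esub> b, y) \<in> G)" for a
    have hI: "(a \<odot>\<^bsub>B\<^esub> b, h a) \<in> G" if "a \<in> I" for a
      unfolding h_def by (rule theI') (use that Gun in \<open>auto simp: I_def\<close>)
    have heq: "h a = y" if "(a \<odot>\<^bsub>B\<^esub> b, y) \<in> G" "a \<in> carrier R" for a y
      using Gun[OF hI that(1)] that by (auto simp: I_def)
    let ?R = "ring_as_module R"
    have modR: "module R ?R" by (rule module_ring_as_module[OF R.cring_axioms])
    interpret RM: module R ?R by (fact modR)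
    have addI: "a \<oplus>\<^bsub>R\<^esub> a' \<in> I \<and> h (a \<oplus>\<^bsub>R\<^esub> a') = h a \<oplus>\<^bsub>E\<^esub> h a'" if "a \<in> I" "a' \<in> I" for a a'
    proof -
      have c: "a \<in> carrier R" "a' \<in> carrier R" using that by (auto simp: I_def)
      have "((a \<oplus>\<^bsub>R\<^esub> a') \<odot>\<^bsub>B\<^esub> b, h a \<oplus>\<^bsub>E\<^esub> h a') \<in> G"
        using Gadd[OF hI[OF that(1)] hI[OF that(2)]] c b by (simp add: B.smult_l_distr)
      then show ?thesis using heq c by (auto simp: I_def)
    qed
    have smI: "a \<otimes>\<^bsub>R\<^esub> a' \<in> I \<and> h (a \<otimes>\<^bsub>R\<^esub> a') = a \<odot>\<^bsub>E\<^esub> h a'" if "a \<in> carrier R" "a' \<in> I" for a a'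
    proof -
      have c: "a' \<in> carrier R" using that by (auto simp: I_def)
      have "((a \<otimes>\<^bsub>R\<^esub> a') \<odot>\<^bsub>B\<^esub> b, a \<odot>\<^bsub>E\<^esub> h a') \<in> G"
        using Gsm[OF that(1) hI[OF that(2)]] that c b by (simp add: B.smult_assoc1)
      then show ?thesis using heq c that by (auto simp: I_def)
    qed
    have I0: "\<zero>\<^bsub>R\<^esub> \<in> I" using G0 b by (auto simp: I_def)
    have sub: "submodule I R ?R"
    proof (rule RM.submoduleI)
      show "I \<subseteq> carrier ?R" by (auto simp: I_def ring_as_module_def)
      show "\<zero>\<^bsub>?R\<^esub> \<in> I" using I0 by (simp add: ring_as_module_def)
      show "a \<oplus>\<^bsub>?R\<^esub> a' \<in> I" if "a \<in> I" "a' \<in> I" for a a'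
        using addI that by (simp add: ring_as_module_def)
      show sm: "a \<odot>\<^bsub>?R\<^esub> a' \<in> I" if "a \<in> carrier R" "a' \<in> I" for a a'
        using smI that by (simp add: ring_as_module_def)
      show "\<ominus>\<^bsub>?R\<^esub> a \<in> I" if "a \<in> I" for a
      proof -
        have "a \<in> carrier ?R" using that by (auto simp: I_def ring_as_module_def)
        then have "\<ominus>\<^bsub>?R\<^esub> a = (\<ominus>\<^bsub>R\<^esub> \<one>\<^bsub>R\<^esub>) \<odot>\<^bsub>?R\<^esub> a" by (simp add: RM.smult_l_minus)
        then show ?thesis using sm that by simp
      qed
    qed
    have "h \<in> mod_hom R (?R\<lparr>carrier := I\<rparr>) E"
      using addI smI Gc(2)[OF hI] by (auto simp: mod_hom_def ring_as_module_def)
    then obtain g where g: "g \<in> mod_hom R ?R E" and gh: "\<And>a. a \<in> I \<Longrightarrow> g a = h a"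
      using inj modR sub unfolding injective_module_def by blast
    define e where "e = g \<one>\<^bsub>R\<^esub>"
    have e: "e \<in> carrier E" using mod_homD(1)[OF g] by (simp add: e_def ring_as_module_def)
    have ga: "g a = a \<odot>\<^bsub>E\<^esub> e" if "a \<in> carrier R" for a
      using mod_homD(3)[OF g that, of "\<one>\<^bsub>R\<^esub>"] that by (simp add: e_def ring_as_module_def)
    define G' where "G' = {(x \<oplus>\<^bsub>B\<^esub> a \<odot>\<^bsub>B\<^esub> b, y \<oplus>\<^bsub>E\<^esub> a \<odot>\<^bsub>E\<^esub> e) | x y a. (x, y) \<in> G \<and> a \<in> carrier R}"
    have G'I: "(x \<oplus>\<^bsub>B\<^esub> a \<odot>\<^bsub>B\<^esub> b, y \<oplus>\<^bsub>E\<^esub> a \<odot>\<^bsub>E\<^esub> e) \<in> G'" if "(x, y) \<in> G" "a \<in> carrier R" for x y a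
      using that by (auto simp: G'_def)
    have GG': "G \<subseteq> G'"
      using G'I[OF _ R.zero_closed] Gc b e by fastforce
    have "P G'"
      unfolding P_def
    proof (intro conjI allI impI)
      show "G' \<subseteq> carrier B \<times> carrier E" using Gc b e by (auto simp: G'_def)
      show "(\<lambda>x. (x, f x)) ` A \<subseteq> G'" using GA GG' by auto
    next
      fix p q p' q' assume "(p, q) \<in> G'" "(p', q') \<in> G'"
      then obtain x y a x' y' a' where
        *: "(x, y) \<in> G" "a \<in> carrier R" "p = x \<oplus>\<^bsub>B\<^esub> a \<odot>\<^bsub>B\<^esub> b" "q = y \<oplus>\<^bsub>E\<^esub> a \<odot>\<^bsub>E\<^esub> e"
           "(x', y') \<in> G" "a' \<in> carrier R" "p' = x' \<oplus>\<^bsub>B\<^esub> a' \<odot>\<^bsub>B\<^esub> b" "q' = y' \<oplus>\<^bsub>E\<^esub> a' \<odot>\<^bsub>E\<^esub> e"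
        by (auto simp: G'_def)
      note c = Gc[OF *(1)] Gc[OF *(5)]
      have "p \<oplus>\<^bsub>B\<^esub> p' = (x \<oplus>\<^bsub>B\<^esub> x') \<oplus>\<^bsub>B\<^esub> (a \<oplus>\<^bsub>R\<^esub> a') \<odot>\<^bsub>B\<^esub> b"
        using * c b by (simp add: B.smult_l_distr B.M.a_ac)
      moreover have "q \<oplus>\<^bsub>E\<^esub> q' = (y \<oplus>\<^bsub>E\<^esub> y') \<oplus>\<^bsub>E\<^esub> (a \<oplus>\<^bsub>R\<^esub> a') \<odot>\<^bsub>E\<^esub> e"
        using * c e by (simp add: E.smult_l_distr E.M.a_ac)
      ultimately show "(p \<oplus>\<^bsub>B\<^esub> p', q \<oplus>\<^bsub>E\<^esub> q') \<in> G'"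
        using G'I[OF Gadd[OF *(1) *(5)], of "a \<oplus>\<^bsub>R\<^esub> a'"] * by simp
    next
      fix s p q assume s: "s \<in> carrier R" and "(p, q) \<in> G'"
      then obtain x y a where
        *: "(x, y) \<in> G" "a \<in> carrier R" "p = x \<oplus>\<^bsub>B\<^esub> a \<odot>\<^bsub>B\<^esub> b" "q = y \<oplus>\<^bsub>E\<^esub> a \<odot>\<^bsub>E\<^esub> e"
        by (auto simp: G'_def)
      then show "(s \<odot>\<^bsub>B\<^esub> p, s \<odot>\<^bsub>E\<^esub> q) \<in> G'"
        using G'I[OF Gsm[OF s *(1)], of "s \<otimes>\<^bsub>R\<^esub> a"] Gc[OF *(1)] s b e
        by (simp add: B.smult_r_distr E.smult_r_distr B.smult_assoc1 E.smult_assoc1)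
    next
      fix p q q' assume "(p, q) \<in> G'" "(p, q') \<in> G'"
      then obtain x y a x' y' a' where
        *: "(x, y) \<in> G" "a \<in> carrier R" "p = x \<oplus>\<^bsub>B\<^esub> a \<odot>\<^bsub>B\<^esub> b" "q = y \<oplus>\<^bsub>E\<^esub> a \<odot>\<^bsub>E\<^esub> e"
           "(x', y') \<in> G" "a' \<in> carrier R" "p = x' \<oplus>\<^bsub>B\<^esub> a' \<odot>\<^bsub>B\<^esub> b" "q' = y' \<oplus>\<^bsub>E\<^esub> a' \<odot>\<^bsub>E\<^esub> e"
        by (auto simp: G'_def)
      note c = Gc[OF *(1)] Gc[OF *(5)]
      define d where "d = a' \<oplus>\<^bsub>R\<^esub> \<ominus>\<^bsub>R\<^esub> a"
      have d: "d \<in> carrier R" and a': "a' = d \<oplus>\<^bsub>R\<^esub> a" using * by (auto simp: d_def R.a_assoc R.l_neg)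
      have "x \<oplus>\<^bsub>B\<^esub> a \<odot>\<^bsub>B\<^esub> b = (x' \<oplus>\<^bsub>B\<^esub> d \<odot>\<^bsub>B\<^esub> b) \<oplus>\<^bsub>B\<^esub> a \<odot>\<^bsub>B\<^esub> b"
        using * c b d a' by (simp add: B.smult_l_distr B.M.a_assoc)
      then have x: "x = x' \<oplus>\<^bsub>B\<^esub> d \<odot>\<^bsub>B\<^esub> b" using c b d * by simp
      have "\<ominus>\<^bsub>B\<^esub> x' \<oplus>\<^bsub>B\<^esub> x = d \<odot>\<^bsub>B\<^esub> b"
        using c b d by (simp add: x B.M.r_neg1)
      then have dG: "(d \<odot>\<^bsub>B\<^esub> b, \<ominus>\<^bsub>E\<^esub> y' \<oplus>\<^bsub>E\<^esub> y) \<in> G" using Gadd[OF Gmin[OF *(5)] *(1)] by simp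
      then have "d \<in> I" using d by (auto simp: I_def)
      then have "d \<odot>\<^bsub>E\<^esub> e = \<ominus>\<^bsub>E\<^esub> y' \<oplus>\<^bsub>E\<^esub> y" using heq[OF dG d] gh ga[OF d] by simp
      then have "y' \<oplus>\<^bsub>E\<^esub> d \<odot>\<^bsub>E\<^esub> e = y" using c by (simp add: E.M.r_neg2)
      then show "q = q'"
        using * c e d a' by (simp add: E.smult_l_distr E.M.a_assoc[symmetric])
    qed
    then have "G' = G" using max GG' by blast
    moreover have "(b, e) \<in> G'" using G'I[OF G0 R.one_closed] b e by simp
    ultimately show ?thesis by blast
  qed
  define g where "g x = (THE y. (x, y) \<in> G)" for x
  have gG: "(x, g x) \<in> G" if "x \<in> carrier B" for x
    unfolding g_def by (rule theI') (use total[OF that] Gun in auto)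
  have geq: "g x = y" if "(x, y) \<in> G" for x y
    by (rule Gun[OF gG[OF Gc(1)[OF that]] that])
  have "g \<in> mod_hom R B E"
    unfolding mod_hom_def
    by (auto intro: Gc(2)[OF gG] geq[OF Gadd[OF gG gG]] geq[OF Gsm[OF _ gG]])
  then show "\<exists>g\<in>mod_hom R B E. \<forall>x\<in>A. g x = f x" using geq GA by blast
qed

section \<open>Matlis duality\<close>

text \<open>Homomorphisms are represented by functions that are \<open>undefined\<close> outside the carrier, so that
  equality in the Hom module is equality on the carrier.\<close>

definition hom_module ::
  "('r, 'x) ring_scheme \<Rightarrow> ('r, 'a) module \<Rightarrow> ('r, 'e) module \<Rightarrow> ('r, 'a \<Rightarrow> 'e) module" where
  "hom_module R M E = \<lparr>carrier = mod_hom R M E \<inter> extensional (carrier M),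
     monoid.mult = undefined, one = undefined,
     zero = (\<lambda>x\<in>carrier M. \<zero>\<^bsub>E\<^esub>),
     add = (\<lambda>f g. \<lambda>x\<in>carrier M. f x \<oplus>\<^bsub>E\<^esub> g x),
     smult = (\<lambda>a f. \<lambda>x\<in>carrier M. a \<odot>\<^bsub>E\<^esub> f x)\<rparr>"

definition dual_map :: "('r, 'a) module \<Rightarrow> ('a \<Rightarrow> 'b) \<Rightarrow> ('b \<Rightarrow> 'e) \<Rightarrow> ('a \<Rightarrow> 'e)" where
  "dual_map M q = (\<lambda>g. \<lambda>x\<in>carrier M. g (q x))"

definition bidual_map ::
  "('r, 'x) ring_scheme \<Rightarrow> ('r, 'e) module \<Rightarrow> ('r, 'a) module \<Rightarrow> 'a \<Rightarrow> ('a \<Rightarrow> 'e) \<Rightarrow> 'e" where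
  "bidual_map R E M x = (\<lambda>f\<in>carrier (hom_module R M E). f x)"

definition matlis_dualizable ::
  "('r, 'x) ring_scheme \<Rightarrow> ('r, 'e) module \<Rightarrow> ('r, 'a) module \<Rightarrow> bool" where
  "matlis_dualizable R E M \<longleftrightarrow>
     bidual_map R E M \<in> mod_iso R M (hom_module R (hom_module R M E) E)"

section \<open>Classes of modules\<close>

definition closed_under_iso :: "('r, 'x) ring_scheme \<Rightarrow> ('r, 'a) module set \<Rightarrow> bool" where
  "closed_under_iso R C \<longleftrightarrow>
     (\<forall>M\<in>C. \<forall>N. module R N \<and> mod_iso R M N \<noteq> {} \<longrightarrow> N \<in> C)"

definition closed_under_submodules :: "('r, 'x) ring_scheme \<Rightarrow> ('r, 'a) module set \<Rightarrow> bool" where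
  "closed_under_submodules R C \<longleftrightarrow>
     (\<forall>M\<in>C. \<forall>L. submodule L R M \<longrightarrow> M\<lparr>carrier := L\<rparr> \<in> C)"

text \<open>The quotient \<open>mod_quot M L\<close> lives over a type of sets, so it is its isomorphic copies over the
  type underlying \<open>C\<close> that belong to \<open>C\<close>.  Such copies exist: take coset representatives.\<close>

definition closed_under_quotients :: "('r, 'x) ring_scheme \<Rightarrow> ('r, 'a) module set \<Rightarrow> bool" where
  "closed_under_quotients R C \<longleftrightarrow>
     (\<forall>M\<in>C. \<forall>L Q. submodule L R M \<and> module R Q \<and> mod_iso R (mod_quot M L) Q \<noteq> {} \<longrightarrow> Q \<in> C)"

text \<open>The modules isomorphic to the dual of a member of \<open>C\<close>.  All of these duals themselves live
  over the type \<open>'a \<Rightarrow> 'e\<close>, so this type carries a copy of each member of the dual class.\<close>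

definition dual_class ::
  "('r, 'x) ring_scheme \<Rightarrow> ('r, 'e) module \<Rightarrow> ('r, 'a) module set \<Rightarrow> ('r, 'a \<Rightarrow> 'e) module set" where
  "dual_class R E C = {N. module R N \<and> (\<exists>M\<in>C. mod_iso R (hom_module R M E) N \<noteq> {})}"

definition submodule_in ::
  "('r, 'x) ring_scheme \<Rightarrow> ('r, 'a) module set \<Rightarrow> 'a set \<Rightarrow> ('r, 'a) module \<Rightarrow> bool" where
  "submodule_in R C L M \<longleftrightarrow> M \<in> C \<and> submodule L R M \<and> M\<lparr>carrier := L\<rparr> \<in> C"

section \<open>Submodule selectors\<close>

text \<open>The value of a selector at \<open>M\<close> is given by its carrier set.\<close>

definition submodule_selector ::
  "('r, 'x) ring_scheme \<Rightarrow> ('r, 'a) module set \<Rightarrow> (('r, 'a) module \<Rightarrow> 'a set) \<Rightarrow> bool" where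
  "submodule_selector R C \<alpha> \<longleftrightarrow>
     (\<forall>M\<in>C. submodule_in R C (\<alpha> M) M) \<and>
     (\<forall>M\<in>C. \<forall>N\<in>C. \<forall>\<phi>\<in>mod_iso R M N. \<phi> ` \<alpha> M = \<alpha> N)"

definition sel_order_preserving ::
  "('r, 'x) ring_scheme \<Rightarrow> ('r, 'a) module set \<Rightarrow> (('r, 'a) module \<Rightarrow> 'a set) \<Rightarrow> bool" where
  "sel_order_preserving R C \<alpha> \<longleftrightarrow>
     (\<forall>M L. submodule_in R C L M \<longrightarrow> \<alpha> (M\<lparr>carrier := L\<rparr>) \<subseteq> \<alpha> M)"

definition sel_surjection_functorial ::
  "('r, 'x) ring_scheme \<Rightarrow> ('r, 'a) module set \<Rightarrow> (('r, 'a) module \<Rightarrow> 'a set) \<Rightarrow> bool" where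
  "sel_surjection_functorial R C \<alpha> \<longleftrightarrow>
     (\<forall>M\<in>C. \<forall>N\<in>C. \<forall>\<pi>\<in>mod_surj R M N. \<pi> ` \<alpha> M \<subseteq> \<alpha> N)"

definition sel_functorial ::
  "('r, 'x) ring_scheme \<Rightarrow> ('r, 'a) module set \<Rightarrow> (('r, 'a) module \<Rightarrow> 'a set) \<Rightarrow> bool" where
  "sel_functorial R C \<alpha> \<longleftrightarrow>
     (\<forall>M\<in>C. \<forall>N\<in>C. \<forall>g\<in>mod_hom R M N. g ` \<alpha> M \<subseteq> \<alpha> N)"

definition sel_idempotent ::
  "('r, 'a) module set \<Rightarrow> (('r, 'a) module \<Rightarrow> 'a set) \<Rightarrow> bool" where
  "sel_idempotent C \<alpha> \<longleftrightarrow> (\<forall>M\<in>C. \<alpha> (M\<lparr>carrier := \<alpha> M\<rparr>) = \<alpha> M)"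

definition interior_operation ::
  "('r, 'x) ring_scheme \<Rightarrow> ('r, 'a) module set \<Rightarrow> (('r, 'a) module \<Rightarrow> 'a set) \<Rightarrow> bool" where
  "interior_operation R C \<alpha> \<longleftrightarrow>
     submodule_selector R C \<alpha> \<and> sel_idempotent C \<alpha> \<and> sel_order_preserving R C \<alpha>"

section \<open>Extensive operations\<close>

text \<open>\<open>e M L\<close> stands for the submodule \<open>L\<^sup>e\<close> of \<open>M\<close>.\<close>

definition extensive_operation ::
  "('r, 'x) ring_scheme \<Rightarrow> ('r, 'a) module set \<Rightarrow> (('r, 'a) module \<Rightarrow> 'a set \<Rightarrow> 'a set) \<Rightarrow> bool" where
  "extensive_operation R C e \<longleftrightarrow>
     (\<forall>M L. submodule_in R C L M \<longrightarrow> submodule (e M L) R M \<and> L \<subseteq> e M L) \<and>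
     (\<forall>M\<in>C. \<forall>N\<in>C. \<forall>\<phi>\<in>mod_iso R M N. \<forall>L. submodule_in R C L M \<longrightarrow> \<phi> ` e M L = e N (\<phi> ` L))"

definition residual_operation ::
  "('r, 'x) ring_scheme \<Rightarrow> ('r, 'a) module set \<Rightarrow> (('r, 'a) module \<Rightarrow> 'a set \<Rightarrow> 'a set) \<Rightarrow> bool" where
  "residual_operation R C r \<longleftrightarrow> extensive_operation R C r \<and>
     (\<forall>M\<in>C. \<forall>P\<in>C. \<forall>q\<in>mod_surj R M P.
        r M {x \<in> carrier M. q x = \<zero>\<^bsub>P\<^esub>} = {x \<in> carrier M. q x \<in> r P {\<zero>\<^bsub>P\<^esub>}})"

definition order_preserving_on_submodules ::
  "('r, 'x) ring_scheme \<Rightarrow> ('r, 'a) module set \<Rightarrow> (('r, 'a) module \<Rightarrow> 'a set \<Rightarrow> 'a set) \<Rightarrow> bool" where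
  "order_preserving_on_submodules R C e \<longleftrightarrow>
     (\<forall>N L M. submodule_in R C L N \<and> submodule_in R C M N \<and> L \<subseteq> M \<longrightarrow> e N L \<subseteq> e N M)"

definition order_preserving_on_ambient_modules ::
  "('r, 'x) ring_scheme \<Rightarrow> ('r, 'a) module set \<Rightarrow> (('r, 'a) module \<Rightarrow> 'a set \<Rightarrow> 'a set) \<Rightarrow> bool" where
  "order_preserving_on_ambient_modules R C e \<longleftrightarrow>
     (\<forall>N L M. submodule_in R C L N \<and> submodule_in R C M N \<and> L \<subseteq> M \<longrightarrow>
        e (N\<lparr>carrier := M\<rparr>) L \<subseteq> e N L)"

definition ext_idempotent ::
  "('r, 'x) ring_scheme \<Rightarrow> ('r, 'a) module set \<Rightarrow> (('r, 'a) module \<Rightarrow> 'a set \<Rightarrow> 'a set) \<Rightarrow> bool" where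
  "ext_idempotent R C e \<longleftrightarrow> (\<forall>M L. submodule_in R C L M \<longrightarrow> e M (e M L) = e M L)"

definition ext_functorial ::
  "('r, 'x) ring_scheme \<Rightarrow> ('r, 'a) module set \<Rightarrow> (('r, 'a) module \<Rightarrow> 'a set \<Rightarrow> 'a set) \<Rightarrow> bool" where
  "ext_functorial R C e \<longleftrightarrow>
     (\<forall>M\<in>C. \<forall>N\<in>C. \<forall>g\<in>mod_hom R M N. \<forall>L. submodule_in R C L M \<longrightarrow> g ` e M L \<subseteq> e N (g ` L))"

definition closure_operation ::
  "('r, 'x) ring_scheme \<Rightarrow> ('r, 'a) module set \<Rightarrow> (('r, 'a) module \<Rightarrow> 'a set \<Rightarrow> 'a set) \<Rightarrow> bool" where
  "closure_operation R C e \<longleftrightarrow>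
     extensive_operation R C e \<and> order_preserving_on_submodules R C e \<and> ext_idempotent R C e"

section \<open>The selector dual to a residual operation\<close>

text \<open>The closure of the zero submodule in a module \<open>X\<close> over an arbitrary type that is isomorphic to
  a member of \<open>C\<close>, obtained by transport of structure.  By lemma \<open>zero_closure_eq\<close> every choice of
  the member and of the isomorphism gives the same submodule.\<close>

definition zero_closure ::
  "('r, 'x) ring_scheme \<Rightarrow> ('r, 'a) module set \<Rightarrow> (('r, 'a) module \<Rightarrow> 'a set \<Rightarrow> 'a set) \<Rightarrow>
    ('r, 'b) module \<Rightarrow> 'b set" where
  "zero_closure R C r X = (\<Union>M\<in>C. \<Union>\<phi>\<in>mod_iso R M X. \<phi> ` r M {\<zero>\<^bsub>M\<^esub>})"

lemma mod_hom_zero: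
  assumes "module R M" "module R N" "\<phi> \<in> mod_hom R M N"
  shows "\<phi> \<zero>\<^bsub>M\<^esub> = \<zero>\<^bsub>N\<^esub>"
proof -
  interpret M: module R M by fact
  interpret N: module R N by fact
  have "\<phi> (\<zero>\<^bsub>R\<^esub> \<odot>\<^bsub>M\<^esub> \<zero>\<^bsub>M\<^esub>) = \<zero>\<^bsub>R\<^esub> \<odot>\<^bsub>N\<^esub> \<phi> \<zero>\<^bsub>M\<^esub>"
    by (rule mod_homD(3)[OF assms(3)]) auto
  then show ?thesis using mod_homD(1)[OF assms(3), of "\<zero>\<^bsub>M\<^esub>"] by simp
qed

lemma zero_closure_eq:
  assumes C: "\<And>M. M \<in> C \<Longrightarrow> module R M" and sub: "closed_under_submodules R C"
    and e: "extensive_operation R C e" and M: "M \<in> C" and \<phi>: "\<phi> \<in> mod_iso R M X"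
  shows "zero_closure R C e X = \<phi> ` e M {\<zero>\<^bsub>M\<^esub>}"
proof -
  have zin: "submodule_in R C {\<zero>\<^bsub>N\<^esub>} N" if "N \<in> C" for N
  proof -
    interpret N: module R N using C that .
    have "submodule {\<zero>\<^bsub>N\<^esub>} R N" by (rule N.submoduleI) auto
    then show ?thesis using sub that by (auto simp: submodule_in_def closed_under_submodules_def)
  qed
  have "\<psi> ` e N {\<zero>\<^bsub>N\<^esub>} = \<phi> ` e M {\<zero>\<^bsub>M\<^esub>}" if N: "N \<in> C" and \<psi>: "\<psi> \<in> mod_iso R N X" for N \<psi>
  proof -
    interpret M: module R M using C M .
    interpret N: module R N using C N .
    have b\<phi>: "bij_betw \<phi> (carrier M) (carrier X)" and h\<phi>: "\<phi> \<in> mod_hom R M X"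
      and b\<psi>: "bij_betw \<psi> (carrier N) (carrier X)" and h\<psi>: "\<psi> \<in> mod_hom R N X"
      using \<phi> \<psi> by (auto simp: mod_iso_def)
    define \<theta> where "\<theta> x = inv_into (carrier M) \<phi> (\<psi> x)" for x
    have \<theta>c: "\<theta> x \<in> carrier M" and \<phi>\<theta>: "\<phi> (\<theta> x) = \<psi> x" if "x \<in> carrier N" for x
    proof -
      have "\<psi> x \<in> \<phi> ` carrier M" using mod_homD(1)[OF h\<psi> that] b\<phi> by (simp add: bij_betw_def)
      then show "\<theta> x \<in> carrier M" "\<phi> (\<theta> x) = \<psi> x"
        by (auto simp: \<theta>_def inv_into_into f_inv_into_f)
    qed
    have eqI: "u = v" if "\<phi> u = \<phi> v" "u \<in> carrier M" "v \<in> carrier M" for u v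
      using b\<phi> that by (auto simp: bij_betw_def inj_on_def)
    have "\<theta> \<in> mod_hom R N M"
      unfolding mod_hom_def
    proof (intro CollectI conjI ballI Pi_I)
      show "\<theta> x \<in> carrier M" if "x \<in> carrier N" for x by (rule \<theta>c[OF that])
      show "\<theta> (x \<oplus>\<^bsub>N\<^esub> y) = \<theta> x \<oplus>\<^bsub>M\<^esub> \<theta> y" if "x \<in> carrier N" "y \<in> carrier N" for x y
        by (rule eqI) (use that \<theta>c \<phi>\<theta> mod_homD[OF h\<phi>] mod_homD[OF h\<psi>] in auto)
      show "\<theta> (a \<odot>\<^bsub>N\<^esub> x) = a \<odot>\<^bsub>M\<^esub> \<theta> x" if "a \<in> carrier R" "x \<in> carrier N" for a x
        by (rule eqI) (use that \<theta>c \<phi>\<theta> mod_homD[OF h\<phi>] mod_homD[OF h\<psi>] in auto)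
    qed
    moreover have "bij_betw \<theta> (carrier N) (carrier M)"
      using bij_betw_trans[OF b\<psi> bij_betw_inv_into[OF b\<phi>]]
      by (simp add: \<theta>_def comp_def cong: bij_betw_cong)
    ultimately have \<theta>: "\<theta> \<in> mod_iso R N M" by (simp add: mod_iso_def)
    have "\<theta> ` e N {\<zero>\<^bsub>N\<^esub>} = e M (\<theta> ` {\<zero>\<^bsub>N\<^esub>})"
      using e N M \<theta> zin[OF N] unfolding extensive_operation_def by blast
    also have "\<theta> ` {\<zero>\<^bsub>N\<^esub>} = {\<zero>\<^bsub>M\<^esub>}"
      using mod_hom_zero[OF C[OF N] C[OF M]] \<theta> by (simp add: mod_iso_def)
    finally have *: "e M {\<zero>\<^bsub>M\<^esub>} = \<theta> ` e N {\<zero>\<^bsub>N\<^esub>}" by simp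
    have "e N {\<zero>\<^bsub>N\<^esub>} \<subseteq> carrier N"
      using e zin[OF N] by (intro N.submoduleE(1)) (simp add: extensive_operation_def)
    then show ?thesis unfolding * image_image by (intro image_cong) (auto simp: \<phi>\<theta>)
  qed
  then have "zero_closure R C e X \<subseteq> \<phi> ` e M {\<zero>\<^bsub>M\<^esub>}"
    unfolding zero_closure_def by (intro UN_least) simp
  moreover have "\<phi> ` e M {\<zero>\<^bsub>M\<^esub>} \<subseteq> zero_closure R C e X"
    unfolding zero_closure_def using M \<phi> by (intro UN_upper[THEN subset_trans[rotated]] UN_upper) auto
  ultimately show ?thesis by (rule subset_antisym)
qed

text \<open>With \<open>X = N\<^sup>\<or>\<close> and \<open>Z\<close> the closure of zero in \<open>X\<close>: the elements of \<open>N\<close> that correspond,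
  under the natural map \<open>N \<rightarrow> N\<^sup>\<or>\<^sup>\<or>\<close>, to the image of \<open>(X / Z)\<^sup>\<or> \<rightarrow> X\<^sup>\<or>\<close>, the dual of the
  quotient map.\<close>

definition dual_selector ::
  "('r, 'x) ring_scheme \<Rightarrow> ('r, 'e) module \<Rightarrow> ('r, 'a) module set \<Rightarrow>
    (('r, 'a) module \<Rightarrow> 'a set \<Rightarrow> 'a set) \<Rightarrow> ('r, 'b) module \<Rightarrow> 'b set" where
  "dual_selector R E C r N =
     (let X = hom_module R N E; Z = zero_closure R C r X in
      {x \<in> carrier N. bidual_map R E N x \<in>
         dual_map X (\<lambda>f. Z +>\<^bsub>X\<^esub> f) ` carrier (hom_module R (mod_quot X Z) E)})"

end

theory Submission
  imports Defs
begin

text \<open>A module \<open>N\<close> of the dual class comes with a perfect \<open>E\<close>-valued pairing with a module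
  \<open>M\<close> of \<open>\<M>\<close>.  Since quotients of \<open>M\<close> are dualizable and \<open>E\<close> is injective,
  \<open>L \<mapsto> L\<^sup>\<bottom>\<close> is an inclusion-reversing bijection from the submodules of \<open>M\<close> to those submodules
  of \<open>N\<close> that lie in the dual class, and \<open>M / L\<close> pairs perfectly with \<open>L\<^sup>\<bottom>\<close>.  The defining
  property of a residual operation then becomes \<open>i (L\<^sup>\<bottom>) = (L\<^sup>r)\<^sup>\<bottom>\<close>, which carries (1)--(3)
  across the bijection.  For (4), homomorphisms on either side of the pairing are adjoints of
  homomorphisms on the other side, and inclusions \<open>P \<subseteq> M\<close> dualize to surjections.\<close>

section \<open>Homomorphisms and quotients\<close>

text \<open>Pairings replace actual duals for two reasons. A member of the dual class is only
  isomorphic to some \<open>M\<^sup>\<or>\<close>, and modules, their duals and their quotients live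
  over different types; a pairing fixes no representative and relates modules over any two types. It
  is also symmetric, so an argument about one side serves the other with the variables exchanged.
  Duality of submodules is not symmetric. For \<open>L\<close> inside \<open>M\<close>, the identity
  \<open>L\<^sup>\<bottom>\<^sup>\<bottom> = L\<close> follows from dualizability of
  \<open>M / L\<close>, since functionals separate the points of that quotient. Inside
  \<open>N\<close> no such property of quotients is available. There the identity is obtained for
  those \<open>K\<close> that have a perfect pairing of their own, which is what membership of
  \<open>K\<close> in the dual class supplies.\<close>

lemma mod_hom_minus:
  assumes "module R M" "module R N" "f \<in> mod_hom R M N" "x \<in> carrier M"
  shows "f (\<ominus>\<^bsub>M\<^esub> x) = \<ominus>\<^bsub>N\<^esub> f x"
proof -
  interpret M: module R M by fact
  interpret N: module R N by fact
  have "f x \<oplus>\<^bsub>N\<^esub> f (\<ominus>\<^bsub>M\<^esub> x) = f (x \<oplus>\<^bsub>M\<^esub> \<ominus>\<^bsub>M\<^esub> x)"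
    using mod_homD(2)[OF assms(3)] assms(4) by simp
  also have "\<dots> = \<zero>\<^bsub>N\<^esub>"
    using mod_hom_zero[OF assms(1-3)] assms(4) by (simp add: M.M.r_neg)
  finally show ?thesis
    using mod_homD(1)[OF assms(3)] assms(4) by (metis M.M.a_inv_closed N.M.a_comm N.M.minus_equality)
qed

lemma mod_hom_eq_iff:
  assumes "module R M" "module R N" "f \<in> mod_hom R M N" "x \<in> carrier M" "y \<in> carrier M"
  shows "f x = f y \<longleftrightarrow> f (x \<oplus>\<^bsub>M\<^esub> \<ominus>\<^bsub>M\<^esub> y) = \<zero>\<^bsub>N\<^esub>"
proof -
  interpret M: module R M by fact
  interpret N: module R N by fact
  have "f (x \<oplus>\<^bsub>M\<^esub> \<ominus>\<^bsub>M\<^esub> y) = f x \<oplus>\<^bsub>N\<^esub> \<ominus>\<^bsub>N\<^esub> f y"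
    using mod_homD(2)[OF assms(3)] assms by (simp add: mod_hom_minus)
  then show ?thesis
    using mod_homD(1)[OF assms(3)] assms(4,5)
    by (metis N.M.a_inv_closed N.M.minus_equality N.M.minus_minus N.M.r_neg)
qed

lemma mod_hom_comp:
  "f \<in> mod_hom R M N \<Longrightarrow> g \<in> mod_hom R N P \<Longrightarrow> (\<lambda>x. g (f x)) \<in> mod_hom R M P"
  by (auto simp: mod_hom_def Pi_iff)

lemma mod_hom_cong:
  assumes "module R M" "\<And>x. x \<in> carrier M \<Longrightarrow> f x = g x"
  shows "f \<in> mod_hom R M N \<longleftrightarrow> g \<in> mod_hom R M N"
proof -
  interpret module R M by fact
  show ?thesis using assms(2) by (auto simp: mod_hom_def Pi_iff)
qed

lemma mod_hom_subset:
  "f \<in> mod_hom R M N \<Longrightarrow> A \<subseteq> carrier M \<Longrightarrow> f \<in> mod_hom R (M\<lparr>carrier := A\<rparr>) N"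
  by (auto simp: mod_hom_def Pi_iff subset_iff)

lemma mod_hom_codomain:
  "f \<in> mod_hom R M N \<Longrightarrow> f ` carrier M \<subseteq> B \<Longrightarrow> f \<in> mod_hom R M (N\<lparr>carrier := B\<rparr>)"
  by (auto simp: mod_hom_def Pi_iff)

lemma mod_iso_inv:
  assumes M: "module R M" and f: "f \<in> mod_iso R M N"
  shows "inv_into (carrier M) f \<in> mod_iso R N M"
proof -
  interpret M: module R M by fact
  have h: "f \<in> mod_hom R M N" and b: "bij_betw f (carrier M) (carrier N)"
    using f by (auto simp: mod_iso_def)
  have c: "inv_into (carrier M) f y \<in> carrier M" "f (inv_into (carrier M) f y) = y"
    if "y \<in> carrier N" for y
    using b that by (auto simp: bij_betw_def inv_into_into f_inv_into_f)
  have eqI: "u = v" if "f u = f v" "u \<in> carrier M" "v \<in> carrier M" for u v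
    using b that by (auto simp: bij_betw_def inj_on_def)
  \<comment> \<open>With only \<open>M\<close> known to be a module, closure of
    \<open>carrier N\<close> under its operations is read off from preimages in
    \<open>M\<close>.\<close>
  have cl: "y \<oplus>\<^bsub>N\<^esub> z \<in> carrier N" if "y \<in> carrier N" "z \<in> carrier N" for y z
    using mod_homD(1,2)[OF h] c that by (metis M.M.a_closed)
  have cl': "a \<odot>\<^bsub>N\<^esub> z \<in> carrier N" if "a \<in> carrier R" "z \<in> carrier N" for a z
    using mod_homD(1,3)[OF h] c that by (metis M.smult_closed)
  have "inv_into (carrier M) f \<in> mod_hom R N M"
    unfolding mod_hom_def
  proof (intro CollectI conjI ballI Pi_I)
    fix x y assume "x \<in> carrier N" "y \<in> carrier N"
    then show "inv_into (carrier M) f (x \<oplus>\<^bsub>N\<^esub> y) =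
        inv_into (carrier M) f x \<oplus>\<^bsub>M\<^esub> inv_into (carrier M) f y"
      by (intro eqI) (simp_all add: c cl mod_homD(2)[OF h])
  next
    fix a x assume "a \<in> carrier R" "x \<in> carrier N"
    then show "inv_into (carrier M) f (a \<odot>\<^bsub>N\<^esub> x) = a \<odot>\<^bsub>M\<^esub> inv_into (carrier M) f x"
      by (intro eqI) (simp_all add: c cl' mod_homD(3)[OF h])
  qed (rule c)
  then show ?thesis using bij_betw_inv_into[OF b] by (simp add: mod_iso_def)
qed

text \<open>Supplies the module axioms for records built by hand, such as quotients and transported
  copies: each axiom pulls back to \<open>M\<close> through preimages. The zero of \<open>N\<close>
  is a free record field, so its agreement with the image of the zero of \<open>M\<close> has to be
  required.\<close>

lemma module_surj_image:
  fixes f :: "'a \<Rightarrow> 'b" and N :: "('r, 'b) module"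
  assumes M: "module R M" and f: "f \<in> mod_surj R M N" and z: "f \<zero>\<^bsub>M\<^esub> = \<zero>\<^bsub>N\<^esub>"
  shows "module R N"
proof -
  interpret M: module R M by fact
  have h: "f \<in> mod_hom R M N" and im: "carrier N = f ` carrier M"
    using f by (auto simp: mod_surj_def)
  note D = mod_homD(2,3)[OF h, symmetric]
  show ?thesis
  proof (rule moduleI[OF M.R.cring_axioms])
    show "abelian_group N"
    proof (rule abelian_groupI)
      show "\<exists>y\<in>carrier N. y \<oplus>\<^bsub>N\<^esub> x = \<zero>\<^bsub>N\<^esub>" if "x \<in> carrier N" for x
      proof -
        obtain u where u: "u \<in> carrier M" "x = f u" using \<open>x \<in> carrier N\<close> im by blast
        then have "f (\<ominus>\<^bsub>M\<^esub> u) \<oplus>\<^bsub>N\<^esub> x = \<zero>\<^bsub>N\<^esub>" by (simp add: D z M.M.l_neg)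
        then show ?thesis using u im by blast
      qed
    qed (auto simp: im D z[symmetric] M.M.a_ac)
  qed (auto simp: im D M.smult_l_distr M.smult_r_distr M.smult_assoc1)
qed

lemma submodule_kernel:
  assumes "module R M" "module R N" "f \<in> mod_hom R M N"
  shows "submodule {x \<in> carrier M. f x = \<zero>\<^bsub>N\<^esub>} R M"
proof -
  interpret M: module R M by fact
  interpret N: module R N by fact
  show ?thesis
    using mod_homD[OF assms(3)] mod_hom_zero[OF assms] mod_hom_minus[OF assms]
    by (intro M.submoduleI) auto
qed

lemma submodule_image:
  assumes "module R M" "module R N" "f \<in> mod_hom R M N" "submodule L R M"
  shows "submodule (f ` L) R N"
proof -
  interpret M: module R M by fact
  interpret N: module R N by fact
  note L = M.submoduleE[OF assms(4)]
  have z: "\<zero>\<^bsub>M\<^esub> \<in> L"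
    using submodule.axioms(1)[OF assms(4)] subgroup.one_closed[of L "add_monoid M"] by simp
  show ?thesis
  proof (rule N.submoduleI)
    show "f ` L \<subseteq> carrier N" using L(1) mod_homD(1)[OF assms(3)] by auto
    show "\<zero>\<^bsub>N\<^esub> \<in> f ` L" using z mod_hom_zero[OF assms(1-3)] by (metis image_eqI)
    show "\<ominus>\<^bsub>N\<^esub> a \<in> f ` L" if a: "a \<in> f ` L" for a
    proof -
      obtain u where u: "u \<in> L" "a = f u" using a by blast
      then have "\<ominus>\<^bsub>N\<^esub> a = f (\<ominus>\<^bsub>M\<^esub> u)" using mod_hom_minus[OF assms(1-3)] L(1) by auto
      then show ?thesis using L(3) u by blast
    qed
    show "a \<oplus>\<^bsub>N\<^esub> b \<in> f ` L" if ab: "a \<in> f ` L" "b \<in> f ` L" for a b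
    proof -
      obtain u v where u: "u \<in> L" "a = f u" "v \<in> L" "b = f v" using ab by blast
      then have "a \<oplus>\<^bsub>N\<^esub> b = f (u \<oplus>\<^bsub>M\<^esub> v)" using mod_homD(2)[OF assms(3)] L(1) by (simp add: subset_iff)
      then show ?thesis using L(5) u by blast
    qed
    show "a \<odot>\<^bsub>N\<^esub> b \<in> f ` L" if ab: "a \<in> carrier R" "b \<in> f ` L" for a b
    proof -
      obtain v where v: "v \<in> L" "b = f v" using ab(2) by blast
      then have "a \<odot>\<^bsub>N\<^esub> b = f (a \<odot>\<^bsub>M\<^esub> v)" using mod_homD(3)[OF assms(3)] L(1) ab by (simp add: subset_iff)
      then show ?thesis using L(4) v ab by blast
    qed
  qed
qed

lemma submodule_restrict_iff:
  assumes "module R M" "submodule P R M"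
  shows "submodule L R (M\<lparr>carrier := P\<rparr>) \<longleftrightarrow> submodule L R M \<and> L \<subseteq> P"
proof -
  interpret M: module R M by fact
  interpret P: module R "M\<lparr>carrier := P\<rparr>" by (rule submodule.submodule_is_module[OF assms(2,1)])
  show ?thesis
    using M.module_incl_imp_submodule[of L] P.module_incl_imp_submodule[of L]
      submodule.submodule_is_module[of L R M] assms(1)
      submodule.submodule_is_module[of L R "M\<lparr>carrier := P\<rparr>"] P.submoduleE(1)[of L]
      M.submoduleE(1)[OF assms(2)] P.module_axioms
    by auto
qed

section \<open>Quotients, transported copies and the Hom module\<close>

lemma factor_through_surj:
  assumes M: "module R M" and N: "module R N" and E: "module R E"
    and q: "q \<in> mod_surj R M N" and f: "f \<in> mod_hom R M E"
    and ker: "\<And>x. x \<in> carrier M \<Longrightarrow> q x = \<zero>\<^bsub>N\<^esub> \<Longrightarrow> f x = \<zero>\<^bsub>E\<^esub>"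
  shows "\<exists>h\<in>mod_hom R N E. \<forall>x\<in>carrier M. h (q x) = f x"
proof -
  interpret M: module R M by fact
  have hq: "q \<in> mod_hom R M N" and im: "carrier N = q ` carrier M"
    using q by (auto simp: mod_surj_def)
  \<comment> \<open>Two preimages of \<open>y\<close> differ by an element of the kernel of
    \<open>q\<close>, which \<open>f\<close> kills, so the chosen preimage is irrelevant.\<close>
  define h where "h y = f (inv_into (carrier M) q y)" for y
  have hf: "h (q x) = f x" if x: "x \<in> carrier M" for x
  proof -
    have y: "inv_into (carrier M) q (q x) \<in> carrier M" "q (inv_into (carrier M) q (q x)) = q x"
      using x by (auto simp: inv_into_into f_inv_into_f)
    have "q (inv_into (carrier M) q (q x) \<oplus>\<^bsub>M\<^esub> \<ominus>\<^bsub>M\<^esub> x) = \<zero>\<^bsub>N\<^esub>"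
      using mod_hom_eq_iff[OF M N hq y(1) x] y by simp
    then show ?thesis
      using mod_hom_eq_iff[OF M E f y(1) x] y x ker by (simp add: h_def)
  qed
  have "h \<in> mod_hom R N E"
    unfolding mod_hom_def using mod_homD[OF f]
    by (auto simp: im hf mod_homD(2,3)[OF hq, symmetric])
  then show ?thesis using hf by blast
qed

lemma mod_quot_projection:
  assumes M: "module R M" and L: "submodule L R M"
  shows "module R (mod_quot M L)"
    and "(\<lambda>x. L +>\<^bsub>M\<^esub> x) \<in> mod_surj R M (mod_quot M L)"
    and "x \<in> carrier M \<Longrightarrow> L +>\<^bsub>M\<^esub> x = \<zero>\<^bsub>mod_quot M L\<^esub> \<longleftrightarrow> x \<in> L"
proof -
  interpret M: module R M by fact
  note LE = M.submoduleE[OF L]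
  interpret L: abelian_subgroup L M
    by (rule abelian_subgroupI3)
       (use submodule.axioms(1)[OF L] M.abelian_group_axioms in \<open>auto intro: additive_subgroup.intro\<close>)
  have coset_eq: "L +>\<^bsub>M\<^esub> y = L +>\<^bsub>M\<^esub> x" if "x \<in> carrier M" "y \<in> L +>\<^bsub>M\<^esub> x" for x y
    using L.a_repr_independence'[OF that(2,1)] by (rule sym)
  \<comment> \<open>Scalar multiplication on \<open>mod_quot\<close> is a union over all
    representatives; the united cosets coincide because \<open>L\<close> is stable under
    scalars.\<close>
  have sm: "(\<Union>y\<in>L +>\<^bsub>M\<^esub> x. L +>\<^bsub>M\<^esub> (a \<odot>\<^bsub>M\<^esub> y)) = L +>\<^bsub>M\<^esub> (a \<odot>\<^bsub>M\<^esub> x)"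
    if a: "a \<in> carrier R" and x: "x \<in> carrier M" for a x
  proof -
    have "L +>\<^bsub>M\<^esub> (a \<odot>\<^bsub>M\<^esub> y) = L +>\<^bsub>M\<^esub> (a \<odot>\<^bsub>M\<^esub> x)" if "y \<in> L +>\<^bsub>M\<^esub> x" for y
    proof -
      obtain l where l: "l \<in> L" "y = l \<oplus>\<^bsub>M\<^esub> x" using \<open>y \<in> L +>\<^bsub>M\<^esub> x\<close> by (auto simp: a_r_coset_def')
      have "a \<odot>\<^bsub>M\<^esub> y = a \<odot>\<^bsub>M\<^esub> l \<oplus>\<^bsub>M\<^esub> a \<odot>\<^bsub>M\<^esub> x"
        using l LE(1) a x by (auto simp: M.smult_r_distr)
      then have "a \<odot>\<^bsub>M\<^esub> y \<in> L +>\<^bsub>M\<^esub> (a \<odot>\<^bsub>M\<^esub> x)"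
        using LE(4)[OF a l(1)] by (auto simp: a_r_coset_def')
      then show ?thesis using coset_eq a x by simp
    qed
    moreover have "x \<in> L +>\<^bsub>M\<^esub> x" using L.a_rcos_self[OF x] .
    ultimately show ?thesis by blast
  qed
  show s: "(\<lambda>x. L +>\<^bsub>M\<^esub> x) \<in> mod_surj R M (mod_quot M L)"
    by (auto simp: mod_surj_def mod_hom_def mod_quot_def A_RCOSETS_def' L.a_rcos_sum sm)
  show k: "L +>\<^bsub>M\<^esub> x = \<zero>\<^bsub>mod_quot M L\<^esub> \<longleftrightarrow> x \<in> L" if "x \<in> carrier M" for x
    using L.a_rcos_const[of x] L.a_rcos_self[OF that] by (auto simp: mod_quot_def)
  show "module R (mod_quot M L)"
    by (rule module_surj_image[OF M s]) (use k[of "\<zero>\<^bsub>M\<^esub>"] in simp)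
qed

text \<open>Renaming of elements. It brings a quotient, whose elements are sets, back to the type of
  the original module, as membership in a class over that type demands.\<close>

lemma transport_module:
  fixes X :: "('r, 'a) module" and g :: "'a \<Rightarrow> 'b"
  assumes X: "module R X" and inj: "inj_on g (carrier X)"
  shows "\<exists>Y :: ('r, 'b) module. module R Y \<and> g \<in> mod_iso R X Y"
proof -
  interpret X: module R X by fact
  let ?i = "inv_into (carrier X) g"
  define Y :: "('r, 'b) module" where
    "Y = \<lparr>carrier = g ` carrier X, monoid.mult = undefined, one = undefined, zero = g \<zero>\<^bsub>X\<^esub>,
      add = (\<lambda>u v. g (?i u \<oplus>\<^bsub>X\<^esub> ?i v)), smult = (\<lambda>a u. g (a \<odot>\<^bsub>X\<^esub> ?i u))\<rparr>"
  have h: "g \<in> mod_hom R X Y"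
    using inj by (auto simp: mod_hom_def Y_def)
  have "module R Y"
    by (rule module_surj_image[OF X]) (use h in \<open>auto simp: mod_surj_def Y_def\<close>)
  moreover have "g \<in> mod_iso R X Y"
    using h inj by (simp add: mod_iso_def bij_betw_def Y_def)
  ultimately show ?thesis by blast
qed

lemma ex_quotient:
  fixes M :: "('r, 'm) module"
  assumes M: "module R M" and L: "submodule L R M"
  shows "\<exists>Q :: ('r, 'm) module. module R Q \<and> mod_iso R (mod_quot M L) Q \<noteq> {} \<and>
           (\<exists>q\<in>mod_surj R M Q. {x \<in> carrier M. q x = \<zero>\<^bsub>Q\<^esub>} = L)"
proof -
  let ?X = "mod_quot M L" and ?p = "\<lambda>x. L +>\<^bsub>M\<^esub> x"
  note P = mod_quot_projection[OF M L]
  have p: "?p \<in> mod_hom R M ?X" and im: "?p ` carrier M = carrier ?X"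
    using P(2) by (auto simp: mod_surj_def)
  \<comment> \<open>Choosing a representative of each coset gives an injection into the type of
    \<open>M\<close>.\<close>
  have "inj_on (inv_into (carrier M) ?p) (carrier ?X)"
    by (rule inj_on_inv_into) (simp add: im)
  from transport_module[OF P(1) this] obtain Q :: "('r, 'm) module" and g
    where Q: "module R Q" and g: "g \<in> mod_iso R ?X Q" by blast
  have gh: "g \<in> mod_hom R ?X Q" and gb: "bij_betw g (carrier ?X) (carrier Q)"
    using g by (auto simp: mod_iso_def)
  have q: "(\<lambda>x. g (?p x)) \<in> mod_surj R M Q"
    using mod_hom_comp[OF p gh] gb im unfolding mod_surj_def bij_betw_def by (auto simp flip: image_image)
  have "g (?p x) = \<zero>\<^bsub>Q\<^esub> \<longleftrightarrow> x \<in> L" if x: "x \<in> carrier M" for x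
  proof -
    interpret X: module R ?X by (rule P(1))
    have "g (?p x) = \<zero>\<^bsub>Q\<^esub> \<longleftrightarrow> g (?p x) = g \<zero>\<^bsub>?X\<^esub>" using mod_hom_zero[OF P(1) Q gh] by simp
    also have "\<dots> \<longleftrightarrow> ?p x = \<zero>\<^bsub>?X\<^esub>"
      using gb mod_homD(1)[OF p x] X.M.zero_closed unfolding bij_betw_def by (metis inj_on_eq_iff)
    finally show ?thesis using P(3)[OF x] by simp
  qed
  then have "{x \<in> carrier M. g (?p x) = \<zero>\<^bsub>Q\<^esub>} = L"
    using module.submoduleE(1)[OF M L] by blast
  then have "\<exists>q\<in>mod_surj R M Q. {x \<in> carrier M. q x = \<zero>\<^bsub>Q\<^esub>} = L"
    using q by (rule bexI)
  moreover have "mod_iso R ?X Q \<noteq> {}" using g by (metis empty_iff)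
  ultimately show ?thesis using Q by (intro exI[of _ Q] conjI)
qed

lemma module_hom_module:
  assumes M: "module R M" and E: "module R E"
  shows "module R (hom_module R M E)"
proof -
  interpret M: module R M by fact
  interpret E: module R E by fact
  note simps = hom_module_def mod_hom_def Pi_iff
  show ?thesis
  proof (rule moduleI[OF M.R.cring_axioms])
    show "abelian_group (hom_module R M E)"
    proof (rule abelian_groupI)
      fix f assume f: "f \<in> carrier (hom_module R M E)"
      then have h: "f \<in> mod_hom R M E" by (simp add: hom_module_def)
      have "(\<lambda>x\<in>carrier M. \<ominus>\<^bsub>E\<^esub> f x) \<in> carrier (hom_module R M E)"
        using mod_homD[OF h] by (auto simp: simps E.M.minus_add E.smult_r_minus)
      moreover have "(\<lambda>x\<in>carrier M. \<ominus>\<^bsub>E\<^esub> f x) \<oplus>\<^bsub>hom_module R M E\<^esub> f = \<zero>\<^bsub>hom_module R M E\<^esub>"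
        using mod_homD[OF h] by (auto simp: hom_module_def E.M.l_neg restrict_def)
      ultimately show "\<exists>g\<in>carrier (hom_module R M E).
          g \<oplus>\<^bsub>hom_module R M E\<^esub> f = \<zero>\<^bsub>hom_module R M E\<^esub>" by blast
    next
      fix f assume "f \<in> carrier (hom_module R M E)"
      then show "\<zero>\<^bsub>hom_module R M E\<^esub> \<oplus>\<^bsub>hom_module R M E\<^esub> f = f"
        by (auto simp: simps intro!: extensionalityI[of _ "carrier M"])
    qed (auto simp: simps E.M.a_ac E.smult_r_distr intro!: restrict_ext)
  next
    fix f assume "f \<in> carrier (hom_module R M E)"
    then show "\<one>\<^bsub>R\<^esub> \<odot>\<^bsub>hom_module R M E\<^esub> f = f"
      by (auto simp: simps intro!: extensionalityI[of _ "carrier M"])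
  next
    fix a f assume "a \<in> carrier R" "f \<in> carrier (hom_module R M E)"
    then show "a \<odot>\<^bsub>hom_module R M E\<^esub> f \<in> carrier (hom_module R M E)"
      by (auto simp: simps E.smult_r_distr E.smult_assoc1[symmetric] M.R.m_comm)
  qed (auto simp: simps E.smult_l_distr E.smult_r_distr E.smult_assoc1 intro!: restrict_ext)
qed

section \<open>Perfect pairings\<close>

text \<open>A symmetric substitute for \<open>N\<close> being the dual of \<open>M\<close>: each
  side represents the functionals on the other. Functionals are compared on carriers only, which
  avoids extensional representatives.\<close>

definition perfect_pairing ::
  "('r, 'x) ring_scheme \<Rightarrow> ('r, 'e) module \<Rightarrow> ('r, 'a) module \<Rightarrow> ('r, 'b) module \<Rightarrow>
    ('a \<Rightarrow> 'b \<Rightarrow> 'e) \<Rightarrow> bool" where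
  "perfect_pairing R E M N b \<longleftrightarrow> module R M \<and> module R N \<and> module R E \<and>
     (\<forall>m\<in>carrier M. b m \<in> mod_hom R N E) \<and>
     (\<forall>n\<in>carrier N. (\<lambda>m. b m n) \<in> mod_hom R M E) \<and>
     (\<forall>f\<in>mod_hom R M E. \<exists>!n. n \<in> carrier N \<and> (\<forall>m\<in>carrier M. b m n = f m)) \<and>
     (\<forall>g\<in>mod_hom R N E. \<exists>!m. m \<in> carrier M \<and> (\<forall>n\<in>carrier N. b m n = g n))"

text \<open>The annihilator of \<open>L\<close> in \<open>N\<close>; with \<open>swap b\<close> it
  becomes the annihilator in \<open>M\<close> of a subset of \<open>N\<close>.\<close>

definition perp :: "('r, 'e) module \<Rightarrow> ('a \<Rightarrow> 'b \<Rightarrow> 'e) \<Rightarrow> 'a set \<Rightarrow> ('r, 'b) module \<Rightarrow> 'b set" where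
  "perp E b L N = {n \<in> carrier N. \<forall>m\<in>L. b m n = \<zero>\<^bsub>E\<^esub>}"

abbreviation (input) swap :: "('a \<Rightarrow> 'b \<Rightarrow> 'e) \<Rightarrow> 'b \<Rightarrow> 'a \<Rightarrow> 'e" where
  "swap b \<equiv> \<lambda>n m. b m n"

lemma perfect_pairing_swap: "perfect_pairing R E M N b \<Longrightarrow> perfect_pairing R E N M (swap b)"
  unfolding perfect_pairing_def by blast

lemma perfect_pairingD:
  assumes "perfect_pairing R E M N b"
  shows "module R M" "module R N" "module R E"
    and "m \<in> carrier M \<Longrightarrow> b m \<in> mod_hom R N E"
    and "n \<in> carrier N \<Longrightarrow> (\<lambda>m. b m n) \<in> mod_hom R M E"
  using assms unfolding perfect_pairing_def by blast+

lemma perfect_pairing_represent: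
  assumes "perfect_pairing R E M N b"
  shows "f \<in> mod_hom R M E \<Longrightarrow> \<exists>n\<in>carrier N. \<forall>m\<in>carrier M. b m n = f m"
    and "g \<in> mod_hom R N E \<Longrightarrow> \<exists>m\<in>carrier M. \<forall>n\<in>carrier N. b m n = g n"
  using assms unfolding perfect_pairing_def by blast+

lemma perfect_pairing_unique:
  assumes "perfect_pairing R E M N b" "g \<in> mod_hom R N E"
  shows "\<exists>!m. m \<in> carrier M \<and> (\<forall>n\<in>carrier N. b m n = g n)"
  using assms unfolding perfect_pairing_def by (elim conjE) (erule bspec)

text \<open>Nondegeneracy, read off from unique representation: \<open>m\<close> and
  \<open>m'\<close> both represent the functional \<open>b m\<close>.\<close>

lemma perfect_pairing_eqI:
  assumes p: "perfect_pairing R E M N b"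
    and "m \<in> carrier M" "m' \<in> carrier M" "\<And>n. n \<in> carrier N \<Longrightarrow> b m n = b m' n"
  shows "m = m'"
proof -
  have "\<exists>!k. k \<in> carrier M \<and> (\<forall>n\<in>carrier N. b k n = b m n)"
    by (rule perfect_pairing_unique[OF p perfect_pairingD(4)[OF p assms(2)]])
  then show ?thesis using assms(2-4) by metis
qed

text \<open>Dualizability says precisely that each functional on the dual is evaluation at a unique
  element of \<open>M\<close>. The other half is the definition of the dual, with restriction to the
  carrier giving the extensional representative.\<close>

lemma perfect_pairing_dual:
  assumes M: "module R M" and E: "module R E" and d: "matlis_dualizable R E M"
  shows "perfect_pairing R E M (hom_module R M E) (\<lambda>m f. f m)"
proof -
  interpret M: module R M by fact
  let ?N = "hom_module R M E"
  note N = module_hom_module[OF M E]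
  interpret N: module R ?N by fact
  have bij: "bij_betw (bidual_map R E M) (carrier M) (carrier (hom_module R ?N E))"
    and hom: "bidual_map R E M \<in> mod_hom R M (hom_module R ?N E)"
    using d by (auto simp: matlis_dualizable_def mod_iso_def)
  have cN: "carrier ?N = mod_hom R M E \<inter> extensional (carrier M)" by (simp add: hom_module_def)
  have ev: "(\<lambda>f. f m) \<in> mod_hom R ?N E" if m: "m \<in> carrier M" for m
    using m by (auto simp: mod_hom_def hom_module_def Pi_iff)
  have un1: "\<exists>!n. n \<in> carrier ?N \<and> (\<forall>m\<in>carrier M. n m = f m)" if f: "f \<in> mod_hom R M E" for f
  proof (rule ex1I[of _ "restrict f (carrier M)"])
    show "restrict f (carrier M) \<in> carrier ?N \<and> (\<forall>m\<in>carrier M. restrict f (carrier M) m = f m)"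
      using mod_hom_cong[OF M, of f "restrict f (carrier M)"] f by (simp add: cN)
    show "n = restrict f (carrier M)" if "n \<in> carrier ?N \<and> (\<forall>m\<in>carrier M. n m = f m)" for n
      using that by (intro extensionalityI[of _ "carrier M"]) (auto simp: cN)
  qed
  have un2: "\<exists>!m. m \<in> carrier M \<and> (\<forall>n\<in>carrier ?N. n m = g n)" if g: "g \<in> mod_hom R ?N E" for g
  proof -
    have eq: "bidual_map R E M m = restrict g (carrier ?N) \<longleftrightarrow> (\<forall>n\<in>carrier ?N. n m = g n)" for m
      by (auto simp: bidual_map_def restrict_def fun_eq_iff)
    have "restrict g (carrier ?N) \<in> carrier (hom_module R ?N E)"
      using mod_hom_cong[OF N, of g "restrict g (carrier ?N)"] g by (simp add: hom_module_def[of R ?N])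
    then have "restrict g (carrier ?N) \<in> bidual_map R E M ` carrier M"
      by (simp only: bij_betw_imp_surj_on[OF bij])
    then obtain m where m: "m \<in> carrier M" "bidual_map R E M m = restrict g (carrier ?N)"
      by (elim imageE) simp
    show ?thesis
    proof (rule ex1I)
      show "m \<in> carrier M \<and> (\<forall>n\<in>carrier ?N. n m = g n)"
        using m eq[of m] by blast
      fix k assume k: "k \<in> carrier M \<and> (\<forall>n\<in>carrier ?N. n k = g n)"
      then have "bidual_map R E M k = bidual_map R E M m"
        using m(2) eq[of k] by metis
      then show "k = m"
        by (rule inj_onD[OF bij_betw_imp_inj_on[OF bij]]) (use k m(1) in simp_all)
    qed
  qed
  have id: "n \<in> mod_hom R M E" if "n \<in> carrier ?N" for n
    using that by (simp add: cN)
  show ?thesis unfolding perfect_pairing_def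
    by (intro conjI ballI M N E; erule ev id un1 un2)
qed

text \<open>Carries the pairing of \<open>M\<close> with its dual over to every isomorphic copy of
  the dual, hence to all members of the dual class.\<close>

lemma perfect_pairing_iso:
  assumes p: "perfect_pairing R E M N b" and N': "module R N'" and \<phi>: "\<phi> \<in> mod_iso R N' N"
  shows "perfect_pairing R E M N' (\<lambda>m n. b m (\<phi> n))"
proof -
  have h: "\<phi> \<in> mod_hom R N' N" and b: "bij_betw \<phi> (carrier N') (carrier N)"
    using \<phi> by (auto simp: mod_iso_def)
  note D = perfect_pairingD[OF p]
  let ?i = "inv_into (carrier N') \<phi>"
  have i: "?i \<in> mod_hom R N N'"
    using mod_iso_inv[OF N' \<phi>] by (simp add: mod_iso_def)
  have \<phi>i: "\<phi> (?i n) = n" if "n \<in> carrier N" for n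
    using b that by (simp add: bij_betw_def f_inv_into_f)
  have eqI: "n = n'" if "n \<in> carrier N'" "n' \<in> carrier N'"
    "\<And>m. m \<in> carrier M \<Longrightarrow> b m (\<phi> n) = b m (\<phi> n')" for n n'
  proof -
    have "\<phi> n = \<phi> n'"
      using perfect_pairing_eqI[OF perfect_pairing_swap[OF p], of "\<phi> n" "\<phi> n'"] that mod_homD(1)[OF h] by blast
    then show ?thesis using b that by (auto simp: bij_betw_def inj_on_def)
  qed
  have un1: "\<exists>!n. n \<in> carrier N' \<and> (\<forall>m\<in>carrier M. b m (\<phi> n) = f m)" if f: "f \<in> mod_hom R M E" for f
  proof -
    obtain n where n: "n \<in> carrier N" "\<forall>m\<in>carrier M. b m n = f m"
      using perfect_pairing_represent(1)[OF p f] by blast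
    show ?thesis
      by (rule ex1I[of _ "?i n"]) (use n \<phi>i mod_homD(1)[OF i] eqI in auto)
  qed
  have un2: "\<exists>!m. m \<in> carrier M \<and> (\<forall>n\<in>carrier N'. b m (\<phi> n) = g n)" if g: "g \<in> mod_hom R N' E" for g
  proof -
    have *: "(\<forall>n\<in>carrier N'. b m (\<phi> n) = g n) \<longleftrightarrow> (\<forall>n\<in>carrier N. b m n = g (?i n))" for m
    proof
      assume *: "\<forall>n\<in>carrier N'. b m (\<phi> n) = g n"
      show "\<forall>n\<in>carrier N. b m n = g (?i n)"
        using *[rule_format, OF mod_homD(1)[OF i]] \<phi>i by simp
    next
      assume *: "\<forall>n\<in>carrier N. b m n = g (?i n)"
      show "\<forall>n\<in>carrier N'. b m (\<phi> n) = g n"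
        using *[rule_format, OF mod_homD(1)[OF h]] bij_betw_inv_into_left[OF b] by simp
    qed
    show ?thesis unfolding * by (rule perfect_pairing_unique[OF p mod_hom_comp[OF i g]])
  qed
  show ?thesis
    unfolding perfect_pairing_def
    using D(1,3) N' un1 un2 D(5)[OF mod_homD(1)[OF h]] mod_hom_comp[OF h D(4)] by blast
qed

text \<open>For fixed \<open>m\<close>, the composite of \<open>b' m\<close> with \<open>g\<close>
  is a functional on \<open>N\<close>, and the element of \<open>M\<close> that represents it is the
  value of the adjoint at \<open>m\<close>. Nondegeneracy turns linearity of \<open>b'\<close> in
  \<open>m\<close> into linearity of the adjoint.\<close>

lemma perfect_pairing_adjoint:
  assumes p: "perfect_pairing R E M N b" and p': "perfect_pairing R E M' N' b'"
    and g: "g \<in> mod_hom R N N'"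
  shows "\<exists>h\<in>mod_hom R M' M. \<forall>m\<in>carrier M'. \<forall>n\<in>carrier N. b (h m) n = b' m (g n)"
proof -
  note D = perfect_pairingD[OF p] and D' = perfect_pairingD[OF p']
  interpret M: module R M by (rule D(1))
  interpret M': module R M' by (rule D'(1))
  have "\<forall>m\<in>carrier M'. \<exists>k\<in>carrier M. \<forall>n\<in>carrier N. b k n = b' m (g n)"
    using perfect_pairing_represent(2)[OF p mod_hom_comp[OF g D'(4)]] by blast
  then obtain h where hc: "\<And>m. m \<in> carrier M' \<Longrightarrow> h m \<in> carrier M"
    and h: "\<And>m n. m \<in> carrier M' \<Longrightarrow> n \<in> carrier N \<Longrightarrow> b (h m) n = b' m (g n)"
    by metis
  have "h \<in> mod_hom R M' M"
    unfolding mod_hom_def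
  proof (intro CollectI conjI ballI Pi_I)
    fix x y assume "x \<in> carrier M'" "y \<in> carrier M'"
    then show "h (x \<oplus>\<^bsub>M'\<^esub> y) = h x \<oplus>\<^bsub>M\<^esub> h y"
      by (intro perfect_pairing_eqI[OF p])
         (simp_all add: hc h mod_homD(2)[OF D(5)] mod_homD(2)[OF D'(5)] mod_homD(1)[OF g])
  next
    fix a x assume "a \<in> carrier R" "x \<in> carrier M'"
    then show "h (a \<odot>\<^bsub>M'\<^esub> x) = a \<odot>\<^bsub>M\<^esub> h x"
      by (intro perfect_pairing_eqI[OF p])
         (simp_all add: hc h mod_homD(3)[OF D(5)] mod_homD(3)[OF D'(5)] mod_homD(1)[OF g])
  qed (rule hc)
  then show ?thesis using h by blast
qed

lemma submodule_perp:
  assumes p: "perfect_pairing R E M N b" and L: "L \<subseteq> carrier M"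
  shows "submodule (perp E b L N) R N"
proof -
  note D = perfect_pairingD[OF p]
  interpret N: module R N by (rule D(2))
  interpret E: module R E by (rule D(3))
  have h: "b m \<in> mod_hom R N E" if "m \<in> L" for m
    by (rule D(4)) (use that L in blast)
  note z = mod_hom_zero[OF D(2,3) h] mod_hom_minus[OF D(2,3) h] mod_homD(2,3)[OF h]
  show ?thesis
    by (rule N.submoduleI) (simp_all add: perp_def z subset_iff)
qed

lemma perp_antimono: "L \<subseteq> L' \<Longrightarrow> perp E b L' N \<subseteq> perp E b L N"
  by (auto simp: perp_def)

lemma subset_perp_perp: "L \<subseteq> carrier M \<Longrightarrow> L \<subseteq> perp E (swap b) (perp E b L N) M"
  by (auto simp: perp_def)

section \<open>Submodules under a perfect pairing\<close>

locale dualizable_class =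
  fixes R :: "('r, 'x) ring_scheme" and E :: "('r, 'e) module" and \<M> :: "('r, 'm) module set"
  assumes injective: "injective_module TYPE('r) R E"
    and module: "M \<in> \<M> \<Longrightarrow> module R M"
    and dualizable: "M \<in> \<M> \<Longrightarrow> matlis_dualizable R E M"
    and submodules: "closed_under_submodules R \<M>"
    and quotients: "closed_under_quotients R \<M>"
begin

lemma module_E: "module R E"
  using injective by (simp add: injective_module_def)

text \<open>Injectivity is given against modules over the type of ring elements; Baer's criterion
  extends it to the types of duals.\<close>

lemma extend_hom:
  assumes "module R B" "submodule A R B" "f \<in> mod_hom R (B\<lparr>carrier := A\<rparr>) E"
  shows "\<exists>g\<in>mod_hom R B E. \<forall>x\<in>A. g x = f x"
  using injective_module_any_type[OF injective] assms unfolding injective_module_def by blast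

lemma submodule_in_class: "submodule_in R \<M> L M \<longleftrightarrow> M \<in> \<M> \<and> submodule L R M"
  using submodules unfolding submodule_in_def closed_under_submodules_def by blast

text \<open>Presents \<open>L\<close> as the kernel of a surjection inside \<open>\<M>\<close>, the
  form in which dualizability of \<open>M / L\<close> and the residual condition can be
  applied.\<close>

lemma ex_quotient_class:
  assumes "M \<in> \<M>" "submodule L R M"
  shows "\<exists>Q\<in>\<M>. \<exists>q\<in>mod_surj R M Q. {x \<in> carrier M. q x = \<zero>\<^bsub>Q\<^esub>} = L"
proof -
  obtain Q :: "('r, 'm) module" and q where Q: "module R Q" "mod_iso R (mod_quot M L) Q \<noteq> {}"
    and q: "q \<in> mod_surj R M Q" "{x \<in> carrier M. q x = \<zero>\<^bsub>Q\<^esub>} = L"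
    using ex_quotient[OF module[OF assms(1)] assms(2)] by auto
  have "Q \<in> \<M>"
    using quotients[unfolded closed_under_quotients_def] assms Q by metis
  then show ?thesis using q by blast
qed

text \<open>Functionals separate the points of the dualizable quotient \<open>M / L\<close>. Each of
  them pulls back to \<open>M\<close>, where an element of \<open>L\<^sup>\<bottom>\<close>
  represents it, so whatever \<open>L\<^sup>\<bottom>\<close> kills is zero modulo
  \<open>L\<close>.\<close>

lemma perp_perp:
  assumes M: "M \<in> \<M>" and p: "perfect_pairing R E M N b" and L: "submodule L R M"
  shows "perp E (swap b) (perp E b L N) M = L"
proof
  note D = perfect_pairingD[OF p]
  show "L \<subseteq> perp E (swap b) (perp E b L N) M"
    by (rule subset_perp_perp[OF module.submoduleE(1)[OF D(1) L]])
  obtain Q q where Q: "Q \<in> \<M>" and q: "q \<in> mod_surj R M Q"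
    and ker: "{x \<in> carrier M. q x = \<zero>\<^bsub>Q\<^esub>} = L"
    using ex_quotient_class[OF M L] by blast
  have hq: "q \<in> mod_hom R M Q" using q by (simp add: mod_surj_def)
  note pQ = perfect_pairing_dual[OF module[OF Q] module_E dualizable[OF Q]]
  interpret Q: module R Q by (rule module[OF Q])
  show "perp E (swap b) (perp E b L N) M \<subseteq> L"
  proof
    fix m assume "m \<in> perp E (swap b) (perp E b L N) M"
    then have m: "m \<in> carrier M" and mp: "\<And>n. n \<in> perp E b L N \<Longrightarrow> b m n = \<zero>\<^bsub>E\<^esub>"
      by (auto simp: perp_def)
    have "q m = \<zero>\<^bsub>Q\<^esub>"
    proof (rule perfect_pairing_eqI[OF pQ])
      fix f assume f: "f \<in> carrier (hom_module R Q E)"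
      have fh: "f \<in> mod_hom R Q E" using f by (simp add: hom_module_def)
      have f0: "f \<zero>\<^bsub>Q\<^esub> = \<zero>\<^bsub>E\<^esub>" by (rule mod_hom_zero[OF module[OF Q] module_E fh])
      obtain n where n: "n \<in> carrier N" "\<And>x. x \<in> carrier M \<Longrightarrow> b x n = f (q x)"
        using perfect_pairing_represent(1)[OF p mod_hom_comp[OF hq fh]] by blast
      then have "n \<in> perp E b L N" using ker f0 by (auto simp: perp_def)
      from mp[OF this] show "f (q m) = f \<zero>\<^bsub>Q\<^esub>" using n(2)[OF m] f0 by simp
    qed (use mod_homD(1)[OF hq m] in simp_all)
    then show "m \<in> L" using ker m by blast
  qed
qed

text \<open>Elements of \<open>L\<^sup>\<bottom>\<close> are the functionals on \<open>M\<close>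
  that vanish on \<open>L\<close>, that is, those on \<open>M / L\<close>. Conversely a functional
  on \<open>L\<^sup>\<bottom>\<close> extends to \<open>N\<close> by injectivity of
  \<open>E\<close>, so some \<open>m\<close> represents it, and \<open>m\<close> is determined
  modulo \<open>L\<^sup>\<bottom>\<^sup>\<bottom> = L\<close>.\<close>

lemma perfect_pairing_quotient:
  assumes M: "M \<in> \<M>" and Q: "Q \<in> \<M>" and p: "perfect_pairing R E M N b"
    and q: "q \<in> mod_surj R M Q" and ker: "{x \<in> carrier M. q x = \<zero>\<^bsub>Q\<^esub>} = L"
  shows "\<exists>b'. perfect_pairing R E Q (N\<lparr>carrier := perp E b L N\<rparr>) b' \<and>
           (\<forall>m\<in>carrier M. \<forall>n\<in>perp E b L N. b' (q m) n = b m n)"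
proof -
  note D = perfect_pairingD[OF p]
  let ?P = "perp E b L N"
  let ?N = "N\<lparr>carrier := ?P\<rparr>"
  have hq: "q \<in> mod_hom R M Q" and im: "carrier Q = q ` carrier M"
    using q by (auto simp: mod_surj_def)
  have L: "submodule L R M" using submodule_kernel[OF module[OF M] module[OF Q] hq] ker by simp
  have P: "submodule ?P R N" by (rule submodule_perp[OF p module.submoduleE(1)[OF D(1) L]])
  note N = submodule.submodule_is_module[OF P D(2)]
  interpret M: module R M by (rule D(1))
  have PN: "n \<in> carrier N" if "n \<in> ?P" for n using that by (simp add: perp_def)
  \<comment> \<open>Agreement on \<open>L\<^sup>\<bottom>\<close> means that the difference lies in
    the double annihilator. This serves both well-definedness of \<open>b'\<close> and uniqueness of
    the representing element of \<open>Q\<close>.\<close>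
  have eqq: "q m = q m' \<longleftrightarrow> (\<forall>n\<in>?P. b m n = b m' n)" if m: "m \<in> carrier M" "m' \<in> carrier M" for m m'
  proof -
    have "q m = q m' \<longleftrightarrow> m \<oplus>\<^bsub>M\<^esub> \<ominus>\<^bsub>M\<^esub> m' \<in> L"
      using mod_hom_eq_iff[OF D(1) module[OF Q] hq m] ker m by auto
    also have "\<dots> \<longleftrightarrow> (\<forall>n\<in>?P. b (m \<oplus>\<^bsub>M\<^esub> \<ominus>\<^bsub>M\<^esub> m') n = \<zero>\<^bsub>E\<^esub>)"
      using perp_perp[OF M p L] m unfolding perp_def[of E "swap b"] by auto
    also have "\<dots> \<longleftrightarrow> (\<forall>n\<in>?P. b m n = b m' n)"
      using mod_hom_eq_iff[OF D(1,3) D(5) m] PN by simp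
    finally show ?thesis .
  qed
  define b' where "b' x n = b (inv_into (carrier M) q x) n" for x n
  have b': "b' (q m) n = b m n" if m: "m \<in> carrier M" and n: "n \<in> ?P" for m n
  proof -
    have "inv_into (carrier M) q (q m) \<in> carrier M" "q (inv_into (carrier M) q (q m)) = q m"
      using m by (auto simp: inv_into_into f_inv_into_f)
    then show ?thesis using eqq[OF _ m] n unfolding b'_def by blast
  qed
  have b'1: "b' x \<in> mod_hom R ?N E" if x: "x \<in> carrier Q" for x
  proof -
    obtain m where m: "m \<in> carrier M" "x = q m" using x im by blast
    have "b m \<in> mod_hom R ?N E"
      by (rule mod_hom_subset[OF D(4)[OF m(1)]]) (use PN in blast)
    then show ?thesis
      using mod_hom_cong[OF N, of "b' x" "b m"] b'[OF m(1)] m(2) by simp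
  qed
  have b'2: "(\<lambda>x. b' x n) \<in> mod_hom R Q E" if n: "n \<in> carrier ?N" for n
  proof -
    have n: "n \<in> ?P" using n by simp
    obtain h where h: "h \<in> mod_hom R Q E" "\<And>m. m \<in> carrier M \<Longrightarrow> h (q m) = b m n"
      using factor_through_surj[OF D(1) module[OF Q] D(3) q D(5)[OF PN[OF n]]] n ker
      by (auto simp: perp_def)
    have "(\<lambda>x. b' x n) \<in> mod_hom R Q E \<longleftrightarrow> h \<in> mod_hom R Q E"
      by (rule mod_hom_cong[OF module[OF Q]]) (use h(2) b'[OF _ n] im in auto)
    then show ?thesis using h(1) by simp
  qed
  have un1: "\<exists>!n. n \<in> carrier ?N \<and> (\<forall>x\<in>carrier Q. b' x n = f x)" if f: "f \<in> mod_hom R Q E" for f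
  proof -
    obtain n where n: "n \<in> carrier N" "\<And>m. m \<in> carrier M \<Longrightarrow> b m n = f (q m)"
      using perfect_pairing_represent(1)[OF p mod_hom_comp[OF hq f]] by blast
    have nP: "n \<in> ?P"
      using n ker mod_hom_zero[OF module[OF Q] D(3) f] by (auto simp: perp_def)
    show ?thesis
    proof (rule ex1I)
      show "n \<in> carrier ?N \<and> (\<forall>x\<in>carrier Q. b' x n = f x)"
        using nP n(2) b'[OF _ nP] by (auto simp: im)
      fix k assume "k \<in> carrier ?N \<and> (\<forall>x\<in>carrier Q. b' x k = f x)"
      then have kP: "k \<in> ?P" and k: "\<And>m. m \<in> carrier M \<Longrightarrow> b' (q m) k = f (q m)"
        by (auto simp: im)
      show "k = n"
        by (rule perfect_pairing_eqI[OF perfect_pairing_swap[OF p] PN[OF kP] n(1)])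
           (use k n(2) b'[OF _ kP] in simp)
    qed
  qed
  have un2: "\<exists>!x. x \<in> carrier Q \<and> (\<forall>n\<in>carrier ?N. b' x n = g n)" if g: "g \<in> mod_hom R ?N E" for g
  proof -
    obtain g' where g': "g' \<in> mod_hom R N E" "\<And>n. n \<in> ?P \<Longrightarrow> g' n = g n"
      using extend_hom[OF D(2) P g] by blast
    obtain m where m: "m \<in> carrier M" "\<And>n. n \<in> carrier N \<Longrightarrow> b m n = g' n"
      using perfect_pairing_represent(2)[OF p g'(1)] by blast
    have mg: "b m n = g n" if "n \<in> ?P" for n using m(2)[OF PN[OF that]] g'(2)[OF that] by simp
    show ?thesis
    proof (rule ex1I)
      show "q m \<in> carrier Q \<and> (\<forall>n\<in>carrier ?N. b' (q m) n = g n)"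
        using mod_homD(1)[OF hq m(1)] mg b'[OF m(1)] by simp
      fix x assume x: "x \<in> carrier Q \<and> (\<forall>n\<in>carrier ?N. b' x n = g n)"
      then obtain m' where m': "m' \<in> carrier M" "x = q m'" using im by blast
      have "q m' = q m"
        unfolding eqq[OF m'(1) m(1)] using x m'(2) b'[OF m'(1)] mg by simp
      then show "x = q m" using m'(2) by simp
    qed
  qed
  have "perfect_pairing R E Q ?N b'"
    unfolding perfect_pairing_def
    by (intro conjI ballI module[OF Q] N D(3); erule b'1 b'2 un1 un2)
  then show ?thesis using b' by blast
qed

text \<open>The restriction \<open>M = N\<^sup>\<or> \<rightarrow> K\<^sup>\<or> = M'\<close> is onto with kernel \<open>K\<^sup>\<bottom>\<close>, so every element of
  \<open>K\<^sup>\<bottom>\<^sup>\<bottom>\<close> induces a functional on \<open>M'\<close>, which is represented in \<open>K\<close>.\<close>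

lemma perp_perp_dual:
  assumes p: "perfect_pairing R E M N b" and K: "submodule K R N"
    and p': "perfect_pairing R E M' (N\<lparr>carrier := K\<rparr>) b'"
  shows "perp E b (perp E (swap b) K M) N = K"
proof
  note D = perfect_pairingD[OF p] and D' = perfect_pairingD[OF p']
  note KN = module.submoduleE(1)[OF D(2) K]
  show "K \<subseteq> perp E b (perp E (swap b) K M) N"
    using KN by (auto simp: perp_def)
  have "(\<lambda>n. n) \<in> mod_hom R (N\<lparr>carrier := K\<rparr>) N"
    using KN by (auto simp: mod_hom_def)
  then obtain j where j: "j \<in> mod_hom R M M'"
    and bj: "\<And>m k. m \<in> carrier M \<Longrightarrow> k \<in> K \<Longrightarrow> b' (j m) k = b m k"
    using perfect_pairing_adjoint[OF p' p] by fastforce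
  have "\<exists>m\<in>carrier M. j m = m'" if m': "m' \<in> carrier M'" for m'
  proof -
    obtain g where g: "g \<in> mod_hom R N E" "\<And>k. k \<in> K \<Longrightarrow> g k = b' m' k"
      using extend_hom[OF D(2) K D'(4)[OF m']] by blast
    obtain m where m: "m \<in> carrier M" "\<And>n. n \<in> carrier N \<Longrightarrow> b m n = g n"
      using perfect_pairing_represent(2)[OF p g(1)] by blast
    have "j m = m'"
      by (rule perfect_pairing_eqI[OF p' mod_homD(1)[OF j m(1)] m'])
         (use m g bj KN in \<open>auto simp: subset_iff\<close>)
    then show ?thesis using m(1) by blast
  qed
  then have js: "j \<in> mod_surj R M M'"
    using j mod_homD(1)[OF j] unfolding mod_surj_def by blast
  show "perp E b (perp E (swap b) K M) N \<subseteq> K"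
  proof
    fix n assume "n \<in> perp E b (perp E (swap b) K M) N"
    then have n: "n \<in> carrier N"
      and np: "\<And>m. m \<in> carrier M \<Longrightarrow> (\<And>k. k \<in> K \<Longrightarrow> b m k = \<zero>\<^bsub>E\<^esub>) \<Longrightarrow> b m n = \<zero>\<^bsub>E\<^esub>"
      by (auto simp: perp_def)
    have ker: "b m n = \<zero>\<^bsub>E\<^esub>" if m: "m \<in> carrier M" "j m = \<zero>\<^bsub>M'\<^esub>" for m
    proof (rule np[OF m(1)])
      fix k assume k: "k \<in> K"
      have "b m k = b' \<zero>\<^bsub>M'\<^esub> k" using bj[OF m(1) k] m(2) by simp
      also have "\<dots> = \<zero>\<^bsub>E\<^esub>" using mod_hom_zero[OF D'(1,3) D'(5), of k] k by simp
      finally show "b m k = \<zero>\<^bsub>E\<^esub>" .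
    qed
    obtain h where h: "h \<in> mod_hom R M' E" "\<And>m. m \<in> carrier M \<Longrightarrow> h (j m) = b m n"
      using factor_through_surj[OF D(1) D'(1) D(3) js D(5)[OF n] ker] by blast
    obtain k where k: "k \<in> K" "\<And>m. m \<in> carrier M' \<Longrightarrow> b' m k = h m"
      using perfect_pairing_represent(1)[OF p' h(1)] by auto
    have eq: "b m n = b m k" if m: "m \<in> carrier M" for m
      using h(2)[OF m] k(2)[OF mod_homD(1)[OF j m]] bj[OF m k(1)] by simp
    have "n = k"
      by (rule perfect_pairing_eqI[OF perfect_pairing_swap[OF p] n _ eq]) (use k(1) KN in blast)
    then show "n \<in> K" using k(1) by simp
  qed
qed

text \<open>Trades an isomorphism with a dual for a pairing, the form used from here on. In the
  converse direction the isomorphism sends a functional on \<open>M\<close> to the element of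
  \<open>N\<close> that represents it.\<close>

lemma dual_class_iff:
  "N \<in> dual_class R E \<M> \<longleftrightarrow> module R N \<and> (\<exists>M\<in>\<M>. \<exists>b. perfect_pairing R E M N b)"
proof (intro iffI conjI)
  assume N: "N \<in> dual_class R E \<M>"
  show mN: "module R N" using N by (simp add: dual_class_def)
  obtain M \<psi> where M: "M \<in> \<M>" and \<psi>: "\<psi> \<in> mod_iso R (hom_module R M E) N"
    using N by (auto simp: dual_class_def)
  have "mod_iso R N (hom_module R M E) \<noteq> {}"
    using mod_iso_inv[OF module_hom_module[OF module[OF M] module_E] \<psi>] by blast
  then show "\<exists>M\<in>\<M>. \<exists>b. perfect_pairing R E M N b"
    using perfect_pairing_iso[OF perfect_pairing_dual[OF module[OF M] module_E dualizable[OF M]] mN] M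
    by blast
next
  assume "module R N \<and> (\<exists>M\<in>\<M>. \<exists>b. perfect_pairing R E M N b)"
  then obtain M b where M: "M \<in> \<M>" and p: "perfect_pairing R E M N b" and mN: "module R N" by blast
  note D = perfect_pairingD[OF p]
  let ?H = "hom_module R M E"
  note pH = perfect_pairing_dual[OF module[OF M] module_E dualizable[OF M]]
  have "\<forall>f\<in>carrier ?H. \<exists>n. n \<in> carrier N \<and> (\<forall>m\<in>carrier M. b m n = f m)"
    using perfect_pairing_represent(1)[OF p] by (auto simp: hom_module_def)
  from bchoice[OF this] obtain \<psi> where \<psi>: "\<And>f. f \<in> carrier ?H \<Longrightarrow> \<psi> f \<in> carrier N"
    "\<And>f m. f \<in> carrier ?H \<Longrightarrow> m \<in> carrier M \<Longrightarrow> b m (\<psi> f) = f m"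
    by blast
  have H: "(f \<oplus>\<^bsub>?H\<^esub> g) m = f m \<oplus>\<^bsub>E\<^esub> g m" "(a \<odot>\<^bsub>?H\<^esub> f) m = a \<odot>\<^bsub>E\<^esub> f m"
    if "m \<in> carrier M" for f g a m
    using that by (simp_all add: hom_module_def)
  note eqI = perfect_pairing_eqI[OF perfect_pairing_swap[OF p]]
  interpret N: module R N by (rule mN)
  interpret H: module R ?H by (rule module_hom_module[OF module[OF M] module_E])
  have hom: "\<psi> \<in> mod_hom R ?H N"
    unfolding mod_hom_def
  proof (intro CollectI conjI ballI Pi_I)
    fix f g assume "f \<in> carrier ?H" "g \<in> carrier ?H"
    then show "\<psi> (f \<oplus>\<^bsub>?H\<^esub> g) = \<psi> f \<oplus>\<^bsub>N\<^esub> \<psi> g"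
      by (intro eqI) (simp_all add: \<psi> mod_homD(2)[OF D(4)] H)
  next
    fix a f assume "a \<in> carrier R" "f \<in> carrier ?H"
    then show "\<psi> (a \<odot>\<^bsub>?H\<^esub> f) = a \<odot>\<^bsub>N\<^esub> \<psi> f"
      by (intro eqI) (simp_all add: \<psi> mod_homD(3)[OF D(4)] H)
  qed (rule \<psi>(1))
  have inj: "inj_on \<psi> (carrier ?H)"
  proof (rule inj_onI)
    fix f g assume fg: "f \<in> carrier ?H" "g \<in> carrier ?H" "\<psi> f = \<psi> g"
    show "f = g"
      by (rule perfect_pairing_eqI[OF perfect_pairing_swap[OF pH] fg(1,2)])
         (use fg \<psi>(2) in metis)
  qed
  have "n \<in> \<psi> ` carrier ?H" if n: "n \<in> carrier N" for n
  proof -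
    obtain f where f: "f \<in> carrier ?H" "\<And>m. m \<in> carrier M \<Longrightarrow> f m = b m n"
      using perfect_pairing_represent(1)[OF pH D(5)[OF n]] by blast
    have "n = \<psi> f" by (rule eqI[OF n \<psi>(1)[OF f(1)]]) (simp add: \<psi>(2)[OF f(1)] f(2))
    then show ?thesis using f(1) by blast
  qed
  then have "bij_betw \<psi> (carrier ?H) (carrier N)"
    using inj \<psi>(1) unfolding bij_betw_def by blast
  then have "\<psi> \<in> mod_iso R ?H N" using hom by (simp add: mod_iso_def)
  then show "N \<in> dual_class R E \<M>" using mN M unfolding dual_class_def by blast
qed

end

section \<open>The dual selector\<close>

locale residual_dual = dualizable_class R E \<M>
  for R :: "('r, 'x) ring_scheme" and E :: "('r, 'e) module" and \<M> :: "('r, 'm) module set" +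
  fixes r :: "('r, 'm) module \<Rightarrow> 'm set \<Rightarrow> 'm set"
  assumes residual: "residual_operation R \<M> r"
begin

abbreviation i :: "('r, 'b) module \<Rightarrow> 'b set" where
  "i \<equiv> dual_selector R E \<M> r"

abbreviation \<D> :: "('r, 'm \<Rightarrow> 'e) module set" where
  "\<D> \<equiv> dual_class R E \<M>"

lemma extensive: "extensive_operation R \<M> r"
  using residual by (simp add: residual_operation_def)

lemma closure_submodule:
  assumes "M \<in> \<M>" "submodule L R M"
  shows "submodule (r M L) R M" "L \<subseteq> r M L"
  using extensive assms submodule_in_class unfolding extensive_operation_def by blast+

lemma zero_submodule: "M \<in> \<M> \<Longrightarrow> submodule {\<zero>\<^bsub>M\<^esub>} R M"
proof -
  assume "M \<in> \<M>"
  then interpret M: module R M by (rule module)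
  show ?thesis by (rule M.submoduleI) auto
qed

lemma closure_kernel:
  assumes "M \<in> \<M>" "P \<in> \<M>" "q \<in> mod_surj R M P" "{x \<in> carrier M. q x = \<zero>\<^bsub>P\<^esub>} = L"
  shows "r M L = {x \<in> carrier M. q x \<in> r P {\<zero>\<^bsub>P\<^esub>}}"
  using residual assms unfolding residual_operation_def by blast

text \<open>The pairing identifies \<open>M\<close> with \<open>N\<^sup>\<or>\<close> and carries
  the closure of zero in \<open>M\<close> to \<open>Z\<close>. Evaluation at \<open>n\<close>
  factors through the quotient by \<open>Z\<close> exactly when it kills \<open>Z\<close>. In
  particular any \<open>M\<close> in \<open>\<M>\<close> and any pairing may be used to compute
  \<open>i N\<close>.\<close>

lemma dual_selector_perp:
  assumes M: "M \<in> \<M>" and p: "perfect_pairing R E M N b"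
  shows "i N = perp E b (r M {\<zero>\<^bsub>M\<^esub>}) N"
proof -
  note D = perfect_pairingD[OF p]
  interpret M: module R M by (rule D(1))
  let ?X = "hom_module R N E"
  note mX = module_hom_module[OF D(2,3)]
  have cX: "carrier ?X = mod_hom R N E \<inter> extensional (carrier N)" by (simp add: hom_module_def)
  define \<theta> where "\<theta> m = restrict (b m) (carrier N)" for m
  have \<theta>X: "\<theta> m \<in> carrier ?X" if "m \<in> carrier M" for m
    using D(4)[OF that] mod_hom_cong[OF D(2), of "\<theta> m" "b m"] by (simp add: cX \<theta>_def)
  have \<theta>h: "\<theta> \<in> mod_hom R M ?X"
    unfolding mod_hom_def
  proof (intro CollectI conjI ballI Pi_I \<theta>X)
    show "\<theta> (x \<oplus>\<^bsub>M\<^esub> y) = \<theta> x \<oplus>\<^bsub>?X\<^esub> \<theta> y" if "x \<in> carrier M" "y \<in> carrier M" for x y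
      using that by (auto simp: \<theta>_def hom_module_def mod_homD(2)[OF D(5)] intro!: restrict_ext)
    show "\<theta> (a \<odot>\<^bsub>M\<^esub> x) = a \<odot>\<^bsub>?X\<^esub> \<theta> x" if "a \<in> carrier R" "x \<in> carrier M" for a x
      using that by (auto simp: \<theta>_def hom_module_def mod_homD(3)[OF D(5)] intro!: restrict_ext)
  qed
  have "inj_on \<theta> (carrier M)"
  proof (rule inj_onI)
    fix x y assume xy: "x \<in> carrier M" "y \<in> carrier M" "\<theta> x = \<theta> y"
    have "b x n = b y n" if "n \<in> carrier N" for n
      using fun_cong[OF xy(3), of n] that by (simp add: \<theta>_def)
    then show "x = y" by (rule perfect_pairing_eqI[OF p xy(1,2)])
  qed
  moreover have "f \<in> \<theta> ` carrier M" if f: "f \<in> carrier ?X" for f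
  proof -
    obtain m where m: "m \<in> carrier M" "\<And>n. n \<in> carrier N \<Longrightarrow> b m n = f n"
      using perfect_pairing_represent(2)[OF p, of f] f by (auto simp: cX)
    have "f = \<theta> m"
      by (rule extensionalityI[of _ "carrier N"]) (use f m in \<open>auto simp: cX \<theta>_def\<close>)
    then show ?thesis using m(1) by blast
  qed
  ultimately have "bij_betw \<theta> (carrier M) (carrier ?X)"
    unfolding bij_betw_def using \<theta>X by blast
  then have \<theta>: "\<theta> \<in> mod_iso R M ?X" using \<theta>h by (simp add: mod_iso_def)
  define Z where "Z = zero_closure R \<M> r ?X"
  have Z: "Z = \<theta> ` r M {\<zero>\<^bsub>M\<^esub>}"
    unfolding Z_def by (rule zero_closure_eq[OF module submodules extensive M \<theta>])
  note sr = closure_submodule(1)[OF M zero_submodule[OF M]]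
  have rM: "r M {\<zero>\<^bsub>M\<^esub>} \<subseteq> carrier M" by (rule M.submoduleE(1)[OF sr])
  have sZ: "submodule Z R ?X" unfolding Z by (rule submodule_image[OF D(1) mX \<theta>h sr])
  have ZX: "Z \<subseteq> carrier ?X" by (rule module.submoduleE(1)[OF mX sZ])
  let ?Q = "mod_quot ?X Z" and ?pr = "\<lambda>f. Z +>\<^bsub>?X\<^esub> f"
  note P = mod_quot_projection[OF mX sZ]
  have prh: "?pr \<in> mod_hom R ?X ?Q" using P(2) by (simp add: mod_surj_def)
  have "bidual_map R E N n \<in> dual_map ?X ?pr ` carrier (hom_module R ?Q E) \<longleftrightarrow>
      (\<forall>f\<in>Z. f n = \<zero>\<^bsub>E\<^esub>)" if n: "n \<in> carrier N" for n
  proof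
    assume "bidual_map R E N n \<in> dual_map ?X ?pr ` carrier (hom_module R ?Q E)"
    then obtain h where h: "h \<in> mod_hom R ?Q E" and eq: "bidual_map R E N n = dual_map ?X ?pr h"
      by (auto simp: hom_module_def[of R ?Q])
    show "\<forall>f\<in>Z. f n = \<zero>\<^bsub>E\<^esub>"
    proof
      fix f assume f: "f \<in> Z"
      then have fX: "f \<in> carrier ?X" using ZX by blast
      have "f n = h (?pr f)"
        using fun_cong[OF eq, of f] fX by (simp add: bidual_map_def dual_map_def)
      also have "?pr f = \<zero>\<^bsub>?Q\<^esub>" using P(3)[OF fX] f by simp
      also have "h \<zero>\<^bsub>?Q\<^esub> = \<zero>\<^bsub>E\<^esub>" by (rule mod_hom_zero[OF P(1) D(3) h])
      finally show "f n = \<zero>\<^bsub>E\<^esub>" .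
    qed
  next
    assume Zn: "\<forall>f\<in>Z. f n = \<zero>\<^bsub>E\<^esub>"
    have "(\<lambda>f. f n) \<in> mod_hom R ?X E"
      using n by (auto simp: mod_hom_def hom_module_def Pi_iff)
    then have "\<exists>h\<in>mod_hom R ?Q E. \<forall>f\<in>carrier ?X. h (?pr f) = f n"
      by (rule factor_through_surj[OF mX P(1) D(3) P(2)]) (use P(3) Zn in blast)
    then obtain h where h: "h \<in> mod_hom R ?Q E" "\<And>f. f \<in> carrier ?X \<Longrightarrow> h (?pr f) = f n" by blast
    have "restrict h (carrier ?Q) \<in> carrier (hom_module R ?Q E)"
      using mod_hom_cong[OF P(1), of "restrict h (carrier ?Q)" h] h(1)
      by (simp add: hom_module_def[of R ?Q])
    moreover have "bidual_map R E N n = dual_map ?X ?pr (restrict h (carrier ?Q))"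
      unfolding bidual_map_def dual_map_def
      by (rule restrict_ext) (use h(2) mod_homD(1)[OF prh] in simp)
    ultimately show "bidual_map R E N n \<in> dual_map ?X ?pr ` carrier (hom_module R ?Q E)"
      by blast
  qed
  moreover have "(\<forall>f\<in>Z. f n = \<zero>\<^bsub>E\<^esub>) \<longleftrightarrow> (\<forall>m\<in>r M {\<zero>\<^bsub>M\<^esub>}. b m n = \<zero>\<^bsub>E\<^esub>)" if "n \<in> carrier N" for n
    using that by (simp add: Z \<theta>_def)
  ultimately show ?thesis
    unfolding dual_selector_def Let_def perp_def Z_def[symmetric] by (intro Collect_cong) blast
qed

text \<open>The dictionary between \<open>r\<close> and \<open>i\<close>: compute \<open>i\<close>
  on \<open>L\<^sup>\<bottom>\<close> through its pairing with \<open>M / L\<close>, where the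
  residual condition identifies the closure of zero with the image of \<open>r M L\<close>.\<close>

lemma dual_selector_perp_submodule:
  assumes M: "M \<in> \<M>" and p: "perfect_pairing R E M N b" and L: "submodule L R M"
  shows "i (N\<lparr>carrier := perp E b L N\<rparr>) = perp E b (r M L) N"
proof -
  note D = perfect_pairingD[OF p]
  obtain Q q where Q: "Q \<in> \<M>" and q: "q \<in> mod_surj R M Q"
    and ker: "{x \<in> carrier M. q x = \<zero>\<^bsub>Q\<^esub>} = L"
    using ex_quotient_class[OF M L] by blast
  obtain b' where p': "perfect_pairing R E Q (N\<lparr>carrier := perp E b L N\<rparr>) b'"
    and b': "\<And>m n. m \<in> carrier M \<Longrightarrow> n \<in> perp E b L N \<Longrightarrow> b' (q m) n = b m n"
    using perfect_pairing_quotient[OF M Q p q ker] by blast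
  have im: "carrier Q = q ` carrier M" using q by (simp add: mod_surj_def)
  note C = closure_kernel[OF M Q q ker]
  \<comment> \<open>Surjectivity of \<open>q\<close> turns the description of \<open>r M L\<close>
    as a preimage into one of an image.\<close>
  have rQ: "r Q {\<zero>\<^bsub>Q\<^esub>} = q ` r M L"
    using module.submoduleE(1)[OF module[OF Q] closure_submodule(1)[OF Q zero_submodule[OF Q]]]
    unfolding C im by auto
  have "i (N\<lparr>carrier := perp E b L N\<rparr>) = {n \<in> perp E b L N. \<forall>m\<in>r M L. b' (q m) n = \<zero>\<^bsub>E\<^esub>}"
    unfolding dual_selector_perp[OF Q p'] rQ by (auto simp: perp_def)
  also have "\<dots> = {n \<in> perp E b L N. \<forall>m\<in>r M L. b m n = \<zero>\<^bsub>E\<^esub>}"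
    using b' module.submoduleE(1)[OF D(1) closure_submodule(1)[OF M L]] by (auto simp: subset_iff)
  \<comment> \<open>Lying in \<open>L\<^sup>\<bottom>\<close> is automatic for what annihilates
    \<open>r M L\<close>, because \<open>L \<subseteq> r M L\<close>.\<close>
  also have "\<dots> = perp E b (r M L) N"
    using closure_submodule(2)[OF M L] by (auto simp: perp_def)
  finally show ?thesis .
qed

section \<open>The order-reversing correspondence of submodules\<close>

lemma perp_subset_iff:
  assumes M: "M \<in> \<M>" and p: "perfect_pairing R E M N b"
    and L: "submodule L R M" and L': "submodule L' R M"
  shows "perp E b L' N \<subseteq> perp E b L N \<longleftrightarrow> L \<subseteq> L'"
proof
  assume "perp E b L' N \<subseteq> perp E b L N"
  then have "perp E (swap b) (perp E b L N) M \<subseteq> perp E (swap b) (perp E b L' N) M"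
    by (rule perp_antimono)
  then show "L \<subseteq> L'" unfolding perp_perp[OF M p L] perp_perp[OF M p L'] .
qed (rule perp_antimono)

lemma perp_eq_iff:
  assumes "M \<in> \<M>" "perfect_pairing R E M N b" "submodule L R M" "submodule L' R M"
  shows "perp E b L N = perp E b L' N \<longleftrightarrow> L = L'"
  using perp_perp[OF assms(1,2)] assms(3,4) by metis

lemma dual_in_class: "M \<in> \<M> \<Longrightarrow> hom_module R M E \<in> \<D>"
  using dual_class_iff module_hom_module[OF module module_E]
    perfect_pairing_dual[OF module module_E dualizable] by blast

lemma dual_class_pairing:
  assumes "N \<in> \<D>"
  obtains M b where "M \<in> \<M>" "perfect_pairing R E M N b"
  using assms dual_class_iff by blast

text \<open>The induced pairing with \<open>M / L\<close> witnesses membership of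
  \<open>L\<^sup>\<bottom>\<close> in the dual class.\<close>

lemma perp_submodule_in:
  assumes M: "M \<in> \<M>" and p: "perfect_pairing R E M N b" and L: "submodule L R M"
  shows "submodule_in R \<D> (perp E b L N) N"
proof -
  note D = perfect_pairingD[OF p]
  obtain Q q where Q: "Q \<in> \<M>" and q: "q \<in> mod_surj R M Q"
    and ker: "{x \<in> carrier M. q x = \<zero>\<^bsub>Q\<^esub>} = L"
    using ex_quotient_class[OF M L] by blast
  obtain b' where p': "perfect_pairing R E Q (N\<lparr>carrier := perp E b L N\<rparr>) b'"
    using perfect_pairing_quotient[OF M Q p q ker] by blast
  have "N\<lparr>carrier := perp E b L N\<rparr> \<in> \<D>" "N \<in> \<D>"
    using dual_class_iff perfect_pairingD(2)[OF p'] D(2) p p' M Q by blast+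
  then show ?thesis
    using submodule_perp[OF p module.submoduleE(1)[OF D(1) L]] by (simp add: submodule_in_def)
qed

text \<open>The pairing that \<open>K\<close> has as a member of the dual class makes it equal to
  its double annihilator, so its annihilator in \<open>M\<close> serves as \<open>L\<close>.\<close>

lemma submodule_in_dual_perp:
  assumes p: "perfect_pairing R E M N b" and K: "submodule_in R \<D> K N"
  obtains L where "submodule L R M" "K = perp E b L N"
proof -
  note D = perfect_pairingD[OF p]
  have sK: "submodule K R N" and NK: "N\<lparr>carrier := K\<rparr> \<in> \<D>" using K by (auto simp: submodule_in_def)
  obtain M' b' where "M' \<in> \<M>" and p': "perfect_pairing R E M' (N\<lparr>carrier := K\<rparr>) b'"
    by (rule dual_class_pairing[OF NK])
  have "submodule (perp E (swap b) K M) R M"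
    by (rule submodule_perp[OF perfect_pairing_swap[OF p] module.submoduleE(1)[OF D(2) sK]])
  then show ?thesis using that perp_perp_dual[OF p sK p'] by metis
qed

text \<open>For invariance under \<open>\<phi>\<close>, the inverse of \<open>\<phi>\<close> pairs
  the same \<open>M\<close> with \<open>N'\<close>, so both values are annihilators of the same
  closure of zero.\<close>

lemma submodule_selector_dual: "submodule_selector R \<D> i"
  unfolding submodule_selector_def
proof (intro conjI ballI)
  fix N assume N: "N \<in> \<D>"
  then obtain M b where M: "M \<in> \<M>" and p: "perfect_pairing R E M N b" by (rule dual_class_pairing)
  show "submodule_in R \<D> (i N) N"
    unfolding dual_selector_perp[OF M p]
    by (rule perp_submodule_in[OF M p closure_submodule(1)[OF M zero_submodule[OF M]]])
  fix N' \<phi> assume N': "N' \<in> \<D>" and \<phi>: "\<phi> \<in> mod_iso R N N'"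
  note D = perfect_pairingD[OF p]
  let ?i = "inv_into (carrier N) \<phi>"
  have b: "bij_betw \<phi> (carrier N) (carrier N')" using \<phi> by (simp add: mod_iso_def)
  have "module R N'" using N' dual_class_iff by blast
  from perfect_pairing_iso[OF p this mod_iso_inv[OF D(2) \<phi>]]
  have p': "perfect_pairing R E M N' (\<lambda>m n. b m (?i n))" .
  show "\<phi> ` i N = i N'"
    unfolding dual_selector_perp[OF M p] dual_selector_perp[OF M p']
  proof (intro subset_antisym subsetI)
    fix y assume "y \<in> \<phi> ` perp E b (r M {\<zero>\<^bsub>M\<^esub>}) N"
    then show "y \<in> perp E (\<lambda>m n. b m (?i n)) (r M {\<zero>\<^bsub>M\<^esub>}) N'"
      using bij_betw_apply[OF b] bij_betw_inv_into_left[OF b] by (auto simp: perp_def)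
  next
    fix y assume "y \<in> perp E (\<lambda>m n. b m (?i n)) (r M {\<zero>\<^bsub>M\<^esub>}) N'"
    then show "y \<in> \<phi> ` perp E b (r M {\<zero>\<^bsub>M\<^esub>}) N"
      using bij_betw_apply[OF bij_betw_inv_into[OF b]] bij_betw_inv_into_right[OF b]
      by (intro image_eqI[of _ _ "?i y"]) (auto simp: perp_def)
  qed
qed

section \<open>Order preservation, idempotence and interior operations\<close>

lemma order_preserving_iff: "order_preserving_on_submodules R \<M> r \<longleftrightarrow> sel_order_preserving R \<D> i"
proof
  assume op: "order_preserving_on_submodules R \<M> r"
  show "sel_order_preserving R \<D> i"
    unfolding sel_order_preserving_def
  proof (intro allI impI)
    fix N K assume K: "submodule_in R \<D> K N"
    then obtain M b where M: "M \<in> \<M>" and p: "perfect_pairing R E M N b"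
      by (auto simp: submodule_in_def elim: dual_class_pairing)
    obtain L where L: "submodule L R M" "K = perp E b L N"
      by (rule submodule_in_dual_perp[OF p K])
    have "\<zero>\<^bsub>M\<^esub> \<in> L"
      using submodule.axioms(1)[OF L(1)] subgroup.one_closed[of L "add_monoid M"] by simp
    \<comment> \<open>Since \<open>N\<close> itself is the annihilator of zero, the inclusion of
      \<open>K\<close> in \<open>N\<close> corresponds to zero being contained in
      \<open>L\<close>.\<close>
    then have "r M {\<zero>\<^bsub>M\<^esub>} \<subseteq> r M L"
      using op M L(1) zero_submodule[OF M] submodule_in_class
      unfolding order_preserving_on_submodules_def by blast
    then show "i (N\<lparr>carrier := K\<rparr>) \<subseteq> i N"
      unfolding L(2) dual_selector_perp_submodule[OF M p L(1)] dual_selector_perp[OF M p]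
      by (rule perp_antimono)
  qed
next
  assume op: "sel_order_preserving R \<D> i"
  show "order_preserving_on_submodules R \<M> r"
    unfolding order_preserving_on_submodules_def submodule_in_class
  proof (intro allI impI, elim conjE)
    fix M L L' assume M: "M \<in> \<M>" and L: "submodule L R M" and L': "submodule L' R M" and LL': "L \<subseteq> L'"
    note p = perfect_pairing_dual[OF module[OF M] module_E dualizable[OF M]]
    let ?N = "hom_module R M E" and ?p = "\<lambda>L. perp E (\<lambda>m f. f m) L (hom_module R M E)"
    note S = perp_submodule_in[OF M p L] perp_submodule_in[OF M p L']
    have "?p L' \<subseteq> ?p L" using LL' by (rule perp_antimono)
    \<comment> \<open>The ambient module is \<open>L\<^sup>\<bottom>\<close> and not the whole dual;
      with the latter, \<open>r M L'\<close> would be compared only with the closure of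
      zero.\<close>
    then have "submodule_in R \<D> (?p L') (?N\<lparr>carrier := ?p L\<rparr>)"
      using S perfect_pairingD(2)[OF p] by (simp add: submodule_in_def submodule_restrict_iff)
    then have "i (?N\<lparr>carrier := ?p L, carrier := ?p L'\<rparr>) \<subseteq> i (?N\<lparr>carrier := ?p L\<rparr>)"
      using op unfolding sel_order_preserving_def by blast
    then have "?p (r M L') \<subseteq> ?p (r M L)"
      by (simp add: dual_selector_perp_submodule[OF M p] L L')
    then show "r M L \<subseteq> r M L'"
      using perp_subset_iff[OF M p closure_submodule(1)[OF M L] closure_submodule(1)[OF M L']] by simp
  qed
qed

text \<open>By the dictionary, each further application of \<open>i\<close> corresponds to a further
  application of \<open>r\<close>: applying \<open>i\<close> twice to \<open>N\<close> gives the
  annihilator of the closure of the closure of zero.\<close>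

lemma idempotent_iff: "ext_idempotent R \<M> r \<longleftrightarrow> sel_idempotent \<D> i"
proof
  assume id: "ext_idempotent R \<M> r"
  show "sel_idempotent \<D> i"
    unfolding sel_idempotent_def
  proof
    fix N assume "N \<in> \<D>"
    then obtain M b where M: "M \<in> \<M>" and p: "perfect_pairing R E M N b" by (rule dual_class_pairing)
    note Z = zero_submodule[OF M]
    have "r M (r M {\<zero>\<^bsub>M\<^esub>}) = r M {\<zero>\<^bsub>M\<^esub>}"
      using id M Z submodule_in_class unfolding ext_idempotent_def by blast
    then show "i (N\<lparr>carrier := i N\<rparr>) = i N"
      unfolding dual_selector_perp[OF M p]
      using dual_selector_perp_submodule[OF M p closure_submodule(1)[OF M Z]] by simp
  qed
next
  assume id: "sel_idempotent \<D> i"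
  show "ext_idempotent R \<M> r"
    unfolding ext_idempotent_def submodule_in_class
  proof (intro allI impI, elim conjE)
    fix M L assume M: "M \<in> \<M>" and L: "submodule L R M"
    note p = perfect_pairing_dual[OF module[OF M] module_E dualizable[OF M]]
    note C = closure_submodule(1)[OF M L]
    \<comment> \<open>The dual of \<open>M\<close> would test only the closure of zero; its
      submodule \<open>L\<^sup>\<bottom>\<close> reaches an arbitrary \<open>L\<close>.\<close>
    let ?K = "(hom_module R M E)\<lparr>carrier := perp E (\<lambda>m f. f m) L (hom_module R M E)\<rparr>"
    have "?K \<in> \<D>" using perp_submodule_in[OF M p L] by (simp add: submodule_in_def)
    then have "i (?K\<lparr>carrier := i ?K\<rparr>) = i ?K" using id unfolding sel_idempotent_def by blast
    then show "r M (r M L) = r M L"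
      using perp_eq_iff[OF M p closure_submodule(1)[OF M C] C]
      by (simp add: dual_selector_perp_submodule[OF M p] L C)
  qed
qed

lemma closure_iff_interior: "closure_operation R \<M> r \<longleftrightarrow> interior_operation R \<D> i"
  using order_preserving_iff idempotent_iff extensive submodule_selector_dual
  unfolding closure_operation_def interior_operation_def by blast

section \<open>Functoriality, adjoints and ambient modules\<close>

lemma functorial_imp_ambient:
  assumes f: "ext_functorial R \<M> r"
  shows "order_preserving_on_ambient_modules R \<M> r"
  unfolding order_preserving_on_ambient_modules_def
proof (intro allI impI, elim conjE)
  fix M L P assume L: "submodule_in R \<M> L M" and P: "submodule_in R \<M> P M" and LP: "L \<subseteq> P"
  have M: "M \<in> \<M>" and PM: "M\<lparr>carrier := P\<rparr> \<in> \<M>" and sP: "submodule P R M"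
    using P by (auto simp: submodule_in_def)
  have inc: "(\<lambda>x. x) \<in> mod_hom R (M\<lparr>carrier := P\<rparr>) M"
    using module.submoduleE(1)[OF module[OF M] sP] by (auto simp: mod_hom_def)
  have "submodule_in R \<M> L (M\<lparr>carrier := P\<rparr>)"
    using L LP PM sP by (simp add: submodule_in_class submodule_restrict_iff[OF module[OF M]])
  from f[unfolded ext_functorial_def, rule_format, OF PM M inc this]
  show "r (M\<lparr>carrier := P\<rparr>) L \<subseteq> r M L" by simp
qed

text \<open>A homomorphism is a surjection onto its image followed by an inclusion.  For a surjection \<open>g\<close>,
  the closure of \<open>g ` L\<close> pulls back to the closure of the kernel of the composite with the
  projection modulo \<open>g ` L\<close>, and this kernel contains \<open>L\<close>.\<close>

lemma ambient_imp_functorial: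
  assumes op: "order_preserving_on_submodules R \<M> r"
    and am: "order_preserving_on_ambient_modules R \<M> r"
  shows "ext_functorial R \<M> r"
  unfolding ext_functorial_def submodule_in_class
proof (intro ballI allI impI, elim conjE)
  fix M N g L
  assume M: "M \<in> \<M>" and N: "N \<in> \<M>" and g: "g \<in> mod_hom R M N" and L: "submodule L R M"
  note mM = module[OF M] and mN = module[OF N]
  let ?I = "g ` carrier M"
  let ?P = "N\<lparr>carrier := ?I\<rparr>"
  have sI: "submodule ?I R N"
    by (rule submodule_image[OF mM mN g module.carrier_is_submodule[OF mM]])
  have P: "?P \<in> \<M>" using submodule_in_class[of ?I N] N sI by (simp add: submodule_in_def)
  have gP: "g \<in> mod_hom R M ?P" by (rule mod_hom_codomain[OF g]) simp
  have LM: "L \<subseteq> carrier M" by (rule module.submoduleE(1)[OF mM L])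
  have gL: "submodule (g ` L) R ?P" by (rule submodule_image[OF mM module[OF P] gP L])
  obtain Q q where Q: "Q \<in> \<M>" and q: "q \<in> mod_surj R ?P Q"
    and ker: "{x \<in> carrier ?P. q x = \<zero>\<^bsub>Q\<^esub>} = g ` L"
    using ex_quotient_class[OF P gL] by blast
  have hq: "q \<in> mod_hom R ?P Q" using q by (simp add: mod_surj_def)
  have "(\<lambda>x. q (g x)) ` carrier M = carrier Q"
    using q by (simp add: mod_surj_def image_image[symmetric])
  then have qg: "(\<lambda>x. q (g x)) \<in> mod_surj R M Q"
    using mod_hom_comp[OF gP hq] by (simp add: mod_surj_def)
  let ?K = "{x \<in> carrier M. q (g x) = \<zero>\<^bsub>Q\<^esub>}"
  have sK: "submodule ?K R M" by (rule submodule_kernel[OF mM module[OF Q] mod_hom_comp[OF gP hq]])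
  have "L \<subseteq> ?K" using ker LM by blast
  then have "r M L \<subseteq> r M ?K"
    using op M L sK submodule_in_class unfolding order_preserving_on_submodules_def by blast
  also have "\<dots> = {x \<in> carrier M. q (g x) \<in> r Q {\<zero>\<^bsub>Q\<^esub>}}"
    by (rule closure_kernel[OF M Q qg refl])
  finally have "g ` r M L \<subseteq> r ?P (g ` L)"
    unfolding closure_kernel[OF P Q q ker] by auto
  also have "\<dots> \<subseteq> r N (g ` L)"
    using am[unfolded order_preserving_on_ambient_modules_def submodule_in_class, rule_format, of N "g ` L" ?I]
      N sI gL[unfolded submodule_restrict_iff[OF mN sI]] by simp
  finally show "g ` r M L \<subseteq> r N (g ` L)" .
qed

text \<open>The adjoint \<open>h\<close> of \<open>g\<close> goes from \<open>M'\<close> to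
  \<open>M\<close> and, by functoriality, maps the closure of zero into the closure of zero. Hence
  \<open>g\<close> sends elements annihilating the closure in \<open>M\<close> to elements
  annihilating the closure in \<open>M'\<close>.\<close>

lemma functorial_imp_selector_functorial:
  assumes f: "ext_functorial R \<M> r"
  shows "sel_functorial R \<D> i"
  unfolding sel_functorial_def
proof (intro ballI)
  fix N N' g assume N: "N \<in> \<D>" and N': "N' \<in> \<D>" and g: "g \<in> mod_hom R N N'"
  obtain M b where M: "M \<in> \<M>" and p: "perfect_pairing R E M N b"
    using N by (rule dual_class_pairing)
  obtain M' b' where M': "M' \<in> \<M>" and p': "perfect_pairing R E M' N' b'"
    using N' by (rule dual_class_pairing)
  obtain h where h: "h \<in> mod_hom R M' M"
    and adj: "\<And>m n. m \<in> carrier M' \<Longrightarrow> n \<in> carrier N \<Longrightarrow> b (h m) n = b' m (g n)"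
    using perfect_pairing_adjoint[OF p p' g] by blast
  have "h ` r M' {\<zero>\<^bsub>M'\<^esub>} \<subseteq> r M (h ` {\<zero>\<^bsub>M'\<^esub>})"
    using f M M' h zero_submodule[OF M'] submodule_in_class unfolding ext_functorial_def by blast
  then have hr: "h ` r M' {\<zero>\<^bsub>M'\<^esub>} \<subseteq> r M {\<zero>\<^bsub>M\<^esub>}"
    using mod_hom_zero[OF module[OF M'] module[OF M] h] by simp
  have rM': "r M' {\<zero>\<^bsub>M'\<^esub>} \<subseteq> carrier M'"
    by (rule module.submoduleE(1)[OF module[OF M'] closure_submodule(1)[OF M' zero_submodule[OF M']]])
  show "g ` i N \<subseteq> i N'"
    unfolding dual_selector_perp[OF M p] dual_selector_perp[OF M' p']
  proof
    fix y assume "y \<in> g ` perp E b (r M {\<zero>\<^bsub>M\<^esub>}) N"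
    then obtain n where n: "n \<in> carrier N" "\<And>m. m \<in> r M {\<zero>\<^bsub>M\<^esub>} \<Longrightarrow> b m n = \<zero>\<^bsub>E\<^esub>" and y: "y = g n"
      by (auto simp: perp_def)
    have "b' m y = \<zero>\<^bsub>E\<^esub>" if m: "m \<in> r M' {\<zero>\<^bsub>M'\<^esub>}" for m
    proof -
      have "m \<in> carrier M'" "h m \<in> r M {\<zero>\<^bsub>M\<^esub>}" using m rM' hr by blast+
      then show ?thesis using adj[of m n] n y by simp
    qed
    then show "y \<in> perp E b' (r M' {\<zero>\<^bsub>M'\<^esub>}) N'"
      using mod_homD(1)[OF g n(1)] y by (simp add: perp_def)
  qed
qed

lemma selector_functorial_imp_surjection_functorial:
  "sel_functorial R \<D> i \<Longrightarrow> sel_surjection_functorial R \<D> i"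
  unfolding sel_functorial_def sel_surjection_functorial_def mod_surj_def by blast

text \<open>Restriction of functionals from \<open>M\<close> to \<open>P\<close> is onto because
  \<open>E\<close> is injective, so the hypothesis on surjections applies to it. An element of the
  closure of zero in \<open>P\<close> is therefore killed by all of \<open>i\<close> of the dual of
  \<open>M\<close>, and the double annihilator puts it in the closure of zero in
  \<open>M\<close>.\<close>

lemma surjection_functorial_imp_zero_closure_subset:
  assumes s: "sel_surjection_functorial R \<D> i" and M: "M \<in> \<M>" and P: "submodule P R M"
  shows "r (M\<lparr>carrier := P\<rparr>) {\<zero>\<^bsub>M\<^esub>} \<subseteq> r M {\<zero>\<^bsub>M\<^esub>}"
proof -
  let ?P = "M\<lparr>carrier := P\<rparr>"
  note mM = module[OF M]
  have PM: "?P \<in> \<M>" using submodule_in_class[of P M] M P by (simp add: submodule_in_def)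
  note mP = module[OF PM]
  note p = perfect_pairing_dual[OF mM module_E dualizable[OF M]]
  note p' = perfect_pairing_dual[OF mP module_E dualizable[OF PM]]
  let ?N = "hom_module R M E" and ?N' = "hom_module R ?P E"
  have sub: "P \<subseteq> carrier M" by (rule module.submoduleE(1)[OF mM P])
  let ?res = "\<lambda>f. restrict f P"
  have resN: "?res f \<in> carrier ?N'" if "f \<in> carrier ?N" for f
    using that mod_hom_cong[OF mP, of "?res f" f] mod_hom_subset[OF _ sub, of f R E]
    by (simp add: hom_module_def)
  have res: "?res \<in> mod_hom R ?N ?N'"
    unfolding mod_hom_def
  proof (intro CollectI conjI ballI Pi_I resN)
    show "?res (f \<oplus>\<^bsub>?N\<^esub> g) = ?res f \<oplus>\<^bsub>?N'\<^esub> ?res g" for f g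
      by (rule ext) (use sub in \<open>auto simp: hom_module_def restrict_def\<close>)
    show "?res (a \<odot>\<^bsub>?N\<^esub> f) = a \<odot>\<^bsub>?N'\<^esub> ?res f" for a f
      by (rule ext) (use sub in \<open>auto simp: hom_module_def restrict_def\<close>)
  qed
  have "h \<in> ?res ` carrier ?N" if h: "h \<in> carrier ?N'" for h
  proof -
    have hh: "h \<in> mod_hom R ?P E" "h \<in> extensional P" using h by (auto simp: hom_module_def)
    obtain f where f: "f \<in> mod_hom R M E" "\<And>x. x \<in> P \<Longrightarrow> f x = h x"
      using extend_hom[OF mM P hh(1)] by blast
    have "restrict f (carrier M) \<in> carrier ?N"
      using mod_hom_cong[OF mM, of "restrict f (carrier M)" f] f(1) by (simp add: hom_module_def)
    moreover have "h = ?res (restrict f (carrier M))"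
      by (rule extensionalityI[OF hh(2)]) (use f(2) sub in auto)
    ultimately show ?thesis by blast
  qed
  then have "?res ` carrier ?N = carrier ?N'" using resN by blast
  then have "?res \<in> mod_surj R ?N ?N'" using res by (simp add: mod_surj_def)
  then have si: "?res ` i ?N \<subseteq> i ?N'"
    using s[unfolded sel_surjection_functorial_def, THEN bspec, OF dual_in_class[OF M], THEN bspec,
        OF dual_in_class[OF PM]] by (rule bspec[rotated])
  note Z = zero_submodule[OF M] and ZP = zero_submodule[OF PM]
  have rP: "r ?P {\<zero>\<^bsub>M\<^esub>} \<subseteq> P"
    using module.submoduleE(1)[OF mP closure_submodule(1)[OF PM ZP]] by simp
  have "f m = \<zero>\<^bsub>E\<^esub>" if m: "m \<in> r ?P {\<zero>\<^bsub>M\<^esub>}" and f: "f \<in> i ?N" for m f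
  proof -
    have "?res f \<in> i ?N'" using si f by blast
    then have "?res f m = \<zero>\<^bsub>E\<^esub>"
      using m unfolding dual_selector_perp[OF PM p'] by (simp add: perp_def)
    then show ?thesis using m rP by auto
  qed
  then have "r ?P {\<zero>\<^bsub>M\<^esub>} \<subseteq> perp E (swap (\<lambda>m f. f m)) (i ?N) M"
    using rP sub by (auto simp: perp_def)
  also have "\<dots> = r M {\<zero>\<^bsub>M\<^esub>}"
    unfolding dual_selector_perp[OF M p] by (rule perp_perp[OF M p closure_submodule(1)[OF M Z]])
  finally show ?thesis .
qed

text \<open>Dividing by \<open>L\<close> reduces to the closure of zero: \<open>q\<close> restricts
  to a surjection from \<open>P\<close> onto its image, again with kernel \<open>L\<close>, and the
  residual condition makes both closures of \<open>L\<close> preimages of closures of zero.\<close>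

lemma surjection_functorial_imp_ambient:
  assumes s: "sel_surjection_functorial R \<D> i"
  shows "order_preserving_on_ambient_modules R \<M> r"
  unfolding order_preserving_on_ambient_modules_def submodule_in_class
proof (intro allI impI, elim conjE)
  fix M L P
  assume M: "M \<in> \<M>" and L: "submodule L R M" and P: "submodule P R M" and LP: "L \<subseteq> P"
  note mM = module[OF M]
  have sub: "P \<subseteq> carrier M" by (rule module.submoduleE(1)[OF mM P])
  let ?P = "M\<lparr>carrier := P\<rparr>"
  have PM: "?P \<in> \<M>" using submodule_in_class[of P M] M P by (simp add: submodule_in_def)
  obtain Q q where Q: "Q \<in> \<M>" and q: "q \<in> mod_surj R M Q"
    and ker: "{x \<in> carrier M. q x = \<zero>\<^bsub>Q\<^esub>} = L"
    using ex_quotient_class[OF M L] by blast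
  have hq: "q \<in> mod_hom R M Q" using q by (simp add: mod_surj_def)
  let ?Q = "Q\<lparr>carrier := q ` P\<rparr>"
  have sQ: "submodule (q ` P) R Q" by (rule submodule_image[OF mM module[OF Q] hq P])
  have QM: "?Q \<in> \<M>" using submodule_in_class[of "q ` P" Q] Q sQ by (simp add: submodule_in_def)
  have "q \<in> mod_hom R ?P ?Q"
    by (rule mod_hom_codomain[OF mod_hom_subset[OF hq sub]]) simp
  then have q': "q \<in> mod_surj R ?P ?Q" by (simp add: mod_surj_def)
  have ker': "{x \<in> carrier ?P. q x = \<zero>\<^bsub>?Q\<^esub>} = L" using ker LP sub by auto
  show "r ?P L \<subseteq> r M L"
    unfolding closure_kernel[OF M Q q ker] closure_kernel[OF PM QM q' ker']
    using surjection_functorial_imp_zero_closure_subset[OF s Q sQ] sub by auto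
qed

end

theorem theorem4p3:
  fixes R :: "('r, 'x) ring_scheme"
    and E :: "('r, 'e) module"
    and \<M> :: "('r, 'm) module set"
    and r :: "('r, 'm) module \<Rightarrow> 'm set \<Rightarrow> 'm set"
  assumes "complete_noetherian_local_ring R"
    and "injective_hull R (residue_field_module R) E"
    and "\<And>M. M \<in> \<M> \<Longrightarrow> module R M"
    and "\<And>M. M \<in> \<M> \<Longrightarrow> matlis_dualizable R E M"
    and "closed_under_iso R \<M>"
    and "closed_under_submodules R \<M>"
    and "closed_under_quotients R \<M>"
    and "residual_operation R \<M> r"
  shows "let \<D> = dual_class R E \<M>;
             i = (dual_selector R E \<M> r :: ('r, 'm \<Rightarrow> 'e) module \<Rightarrow> ('m \<Rightarrow> 'e) set)
    in submodule_selector R \<D> i \<and>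
       (order_preserving_on_submodules R \<M> r \<longleftrightarrow> sel_order_preserving R \<D> i) \<and>
       (ext_idempotent R \<M> r \<longleftrightarrow> sel_idempotent \<D> i) \<and>
       (closure_operation R \<M> r \<longleftrightarrow> interior_operation R \<D> i) \<and>
       (closure_operation R \<M> r \<longrightarrow>
          (ext_functorial R \<M> r \<longleftrightarrow> order_preserving_on_ambient_modules R \<M> r) \<and>
          (order_preserving_on_ambient_modules R \<M> r \<longleftrightarrow> sel_surjection_functorial R \<D> i) \<and>
          (sel_surjection_functorial R \<D> i \<longleftrightarrow> sel_functorial R \<D> i))"
proof -
  have "injective_module TYPE('r) R E" using assms(2) by (simp add: injective_hull_def)
  then interpret residual_dual R E \<M> r
    using assms(3,4,6-8) by (intro residual_dual.intro dualizable_class.intro residual_dual_axioms.intro)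
  have "closure_operation R \<M> r \<Longrightarrow> order_preserving_on_submodules R \<M> r"
    by (simp add: closure_operation_def)
  \<comment> \<open>The arrows (b) to (a), (a) to (d), (d) to (c) and (c) to (b) form a cycle; the
    closure hypothesis enters the first through order preservation on submodules.\<close>
  note imp = ambient_imp_functorial[OF this] functorial_imp_ambient functorial_imp_selector_functorial
    selector_functorial_imp_surjection_functorial surjection_functorial_imp_ambient
  show ?thesis
    unfolding Let_def
  proof (intro conjI impI submodule_selector_dual order_preserving_iff idempotent_iff closure_iff_interior)
  qed (use imp in blast)+
qed

end
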